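(* Let $Q$ be the loop of order $128$ on $B\times N$ defined in the context. Then $Q$ is a Buchsteiner loop that is not conjugacy closed. It is of nilpotency class three and its inner mapping group is abelian. The nucleus of $Q$ is equal to $1\times N$ and coincides with $Q'$; the centre of $Q$ is equal to $\{(1,0),(1,d)\}$ and coincides with $A(Q)$. Finally, $Z(Q/Z(Q))=N(Q)/Z(Q)$.
   Context: Construction of $Q$. Let $B\cong C_2\times C_2\times C_2$ be written multiplicatively with generators $e_1,e_2,e_3$. Let $N\cong C_4\times C_2\times C_2$ be written additively, generated by an element $h$ of order four and a subgroup $\{0,c_1,c_2,c_3\}\cong C_2\times C_2$ that meets $\langle h\rangle$ trivially; put $d=2h$. Indices are taken modulo $3$. Let $B$ act on $N$ by automorphisms via $e_ih=h+d$, $e_ic_i=c_i$, and $e_ic_j=c_j+d$ for $i\ne j$. For $\alpha_i,\beta_i\in\{0,1\}$ put $$\eta\Bigl(\prod e_i^{\alpha_i},\prod e_i^{\beta_i}\Bigr)=\sum_i\alpha_i\beta_{i-1}h+\sum_i(\alpha_i\beta_i+\alpha_{i-1}\beta_{i+1})c_i\in N,$$ $$\delta\Bigl(\prod e_i^{\alpha_i},\prod e_i^{\beta_i}\Bigr)=\sum_i\alpha_i\alpha_{i+1}\beta_i+\sum_i(\alpha_i+\alpha_{i-1})\beta_i\beta_{i+1} \pmod 2,$$ and $\theta(u,v)=\eta(u,v)+\delta(u,v)d$. The operation of $Q$ on $B\times N$ is $$(u,a)\cdot(v,b)=(uv,\ \theta(u,v)+va+b).$$ Definitions. A Buchsteiner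 loop is a loop satisfying $x\backslash (xy\cdot z) = (y\cdot zx)/x$ for all $x,y,z$, where $\backslash$ and $/$ are left and right division. A loop is conjugacy closed if for all $x,y$ the conjugate $L_xL_yL_x^{-1}$ is a left translation and $R_xR_yR_x^{-1}$ is a right translation, where $L_x(y)=xy$, $R_x(y)=yx$. The nucleus $N(Q)$ is the set of all $a$ such that $a(xy)=(ax)y$, $x(ay)=(xa)y$ and $x(ya)=(xy)a$ for all $x,y\in Q$; the centre $Z(Q)$ is the set of elements of $N(Q)$ commuting with all elements of $Q$; nilpotency class is defined from the centre as for groups. $A(Q)$ (resp. $Q'$) is the least normal subloop $K$ such that $Q/K$ is a group (resp. an abelian group). The inner mapping group is the stabilizer of the unit element in the permutation group generated by all $L_x$ and $R_x$. *)

theory Defs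
  imports "HOL-Algebra.Coset" "HOL-Algebra.Bij" "HOL-Algebra.Generated_Groups"
    "HOL-Algebra.Elementary_Groups" "HOL-Algebra.FiniteProduct"
begin

section \<open>Loops\<close>

locale algebraic_loop =
  fixes Q (structure)
  assumes m_closed: "\<lbrakk>x \<in> carrier Q; y \<in> carrier Q\<rbrakk> \<Longrightarrow> x \<otimes> y \<in> carrier Q"
    and one_closed: "\<one> \<in> carrier Q"
    and l_one: "x \<in> carrier Q \<Longrightarrow> \<one> \<otimes> x = x"
    and r_one: "x \<in> carrier Q \<Longrightarrow> x \<otimes> \<one> = x"
    and ex1_ldiv: "\<lbrakk>x \<in> carrier Q; y \<in> carrier Q\<rbrakk> \<Longrightarrow> \<exists>!z. z \<in> carrier Q \<and> x \<otimes> z = y"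
    and ex1_rdiv: "\<lbrakk>x \<in> carrier Q; y \<in> carrier Q\<rbrakk> \<Longrightarrow> \<exists>!z. z \<in> carrier Q \<and> z \<otimes> x = y"

definition ldiv :: "('a, 'm) monoid_scheme \<Rightarrow> 'a \<Rightarrow> 'a \<Rightarrow> 'a" where
  "ldiv Q x y = (THE z. z \<in> carrier Q \<and> x \<otimes>\<^bsub>Q\<^esub> z = y)"

definition rdiv :: "('a, 'm) monoid_scheme \<Rightarrow> 'a \<Rightarrow> 'a \<Rightarrow> 'a" where
  "rdiv Q y x = (THE z. z \<in> carrier Q \<and> z \<otimes>\<^bsub>Q\<^esub> x = y)"

definition buchsteiner_loop :: "('a, 'm) monoid_scheme \<Rightarrow> bool" where
  "buchsteiner_loop Q \<longleftrightarrow> algebraic_loop Q \<and>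
     (\<forall>x\<in>carrier Q. \<forall>y\<in>carrier Q. \<forall>z\<in>carrier Q.
        ldiv Q x ((x \<otimes>\<^bsub>Q\<^esub> y) \<otimes>\<^bsub>Q\<^esub> z) = rdiv Q (y \<otimes>\<^bsub>Q\<^esub> (z \<otimes>\<^bsub>Q\<^esub> x)) x)"

definition left_translation :: "('a, 'm) monoid_scheme \<Rightarrow> 'a \<Rightarrow> 'a \<Rightarrow> 'a" where
  "left_translation Q x = (\<lambda>y\<in>carrier Q. x \<otimes>\<^bsub>Q\<^esub> y)"

definition right_translation :: "('a, 'm) monoid_scheme \<Rightarrow> 'a \<Rightarrow> 'a \<Rightarrow> 'a" where
  "right_translation Q x = (\<lambda>y\<in>carrier Q. y \<otimes>\<^bsub>Q\<^esub> x)"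

definition conjugacy_closed_loop :: "('a, 'm) monoid_scheme \<Rightarrow> bool" where
  "conjugacy_closed_loop Q \<longleftrightarrow> algebraic_loop Q \<and>
     (let S = BijGroup (carrier Q); L = left_translation Q; R = right_translation Q in
      \<forall>x\<in>carrier Q. \<forall>y\<in>carrier Q.
        L x \<otimes>\<^bsub>S\<^esub> L y \<otimes>\<^bsub>S\<^esub> inv\<^bsub>S\<^esub> L x \<in> L ` carrier Q \<and>
        R x \<otimes>\<^bsub>S\<^esub> R y \<otimes>\<^bsub>S\<^esub> inv\<^bsub>S\<^esub> R x \<in> R ` carrier Q)"

definition nucleus :: "('a, 'm) monoid_scheme \<Rightarrow> 'a set" where
  "nucleus Q = {a \<in> carrier Q. \<forall>x\<in>carrier Q. \<forall>y\<in>carrier Q.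
     a \<otimes>\<^bsub>Q\<^esub> (x \<otimes>\<^bsub>Q\<^esub> y) = (a \<otimes>\<^bsub>Q\<^esub> x) \<otimes>\<^bsub>Q\<^esub> y \<and>
     x \<otimes>\<^bsub>Q\<^esub> (a \<otimes>\<^bsub>Q\<^esub> y) = (x \<otimes>\<^bsub>Q\<^esub> a) \<otimes>\<^bsub>Q\<^esub> y \<and>
     x \<otimes>\<^bsub>Q\<^esub> (y \<otimes>\<^bsub>Q\<^esub> a) = (x \<otimes>\<^bsub>Q\<^esub> y) \<otimes>\<^bsub>Q\<^esub> a}"

definition centre :: "('a, 'm) monoid_scheme \<Rightarrow> 'a set" where
  "centre Q = {a \<in> nucleus Q. \<forall>x\<in>carrier Q. a \<otimes>\<^bsub>Q\<^esub> x = x \<otimes>\<^bsub>Q\<^esub> a}"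

definition subloop :: "'a set \<Rightarrow> ('a, 'm) monoid_scheme \<Rightarrow> bool" where
  "subloop K Q \<longleftrightarrow> K \<subseteq> carrier Q \<and> \<one>\<^bsub>Q\<^esub> \<in> K \<and>
     (\<forall>x\<in>K. \<forall>y\<in>K. x \<otimes>\<^bsub>Q\<^esub> y \<in> K \<and> ldiv Q x y \<in> K \<and> rdiv Q x y \<in> K)"

text \<open>
  Normality in the sense of Bruck: \<open>xK = Kx\<close>, \<open>x(yK) = (xy)K\<close> and \<open>(Kx)y = K(xy)\<close>.  These
  subloops are exactly the kernels of loop homomorphisms.  For them the complex product of two
  cosets is again a coset, so that the quotient loop is the library's \<open>Q Mod K\<close>.
\<close>

definition normal_subloop :: "'a set \<Rightarrow> ('a, 'm) monoid_scheme \<Rightarrow> bool" where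
  "normal_subloop K Q \<longleftrightarrow> subloop K Q \<and>
     (\<forall>x\<in>carrier Q. \<forall>y\<in>carrier Q.
        x <#\<^bsub>Q\<^esub> K = K #>\<^bsub>Q\<^esub> x \<and>
        x <#\<^bsub>Q\<^esub> (y <#\<^bsub>Q\<^esub> K) = (x \<otimes>\<^bsub>Q\<^esub> y) <#\<^bsub>Q\<^esub> K \<and>
        (K #>\<^bsub>Q\<^esub> x) #>\<^bsub>Q\<^esub> y = K #>\<^bsub>Q\<^esub> (x \<otimes>\<^bsub>Q\<^esub> y))"

text \<open>\<open>A(Q)\<close> and \<open>Q'\<close>; \<open>LEAST\<close> refers to inclusion of sets.\<close>

definition associator_subloop :: "('a, 'm) monoid_scheme \<Rightarrow> 'a set" where
  "associator_subloop Q = (LEAST K. normal_subloop K Q \<and> group (Q Mod K))"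

definition derived_subloop :: "('a, 'm) monoid_scheme \<Rightarrow> 'a set" where
  "derived_subloop Q = (LEAST K. normal_subloop K Q \<and> comm_group (Q Mod K))"

primrec upper_central :: "('a, 'm) monoid_scheme \<Rightarrow> nat \<Rightarrow> 'a set" where
  "upper_central Q 0 = {\<one>\<^bsub>Q\<^esub>}"
| "upper_central Q (Suc n) =
     {x \<in> carrier Q. upper_central Q n #>\<^bsub>Q\<^esub> x \<in> centre (Q Mod upper_central Q n)}"

definition has_nilpotency_class :: "('a, 'm) monoid_scheme \<Rightarrow> nat \<Rightarrow> bool" where
  "has_nilpotency_class Q n \<longleftrightarrow>
     upper_central Q n = carrier Q \<and> (\<forall>m<n. upper_central Q m \<noteq> carrier Q)"

definition inner_mapping_group :: "('a, 'm) monoid_scheme \<Rightarrow> ('a \<Rightarrow> 'a) monoid" where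
  "inner_mapping_group Q =
     (BijGroup (carrier Q))
       \<lparr>carrier := {f \<in> generate (BijGroup (carrier Q))
                        (left_translation Q ` carrier Q \<union> right_translation Q ` carrier Q).
                     f \<one>\<^bsub>Q\<^esub> = \<one>\<^bsub>Q\<^esub>}\<rparr>"


section \<open>The loop of order 128\<close>

text \<open>
  The element \<open>e\<^sub>1\<^sup>\<alpha> e\<^sub>2\<^sup>\<beta> e\<^sub>3\<^sup>\<gamma>\<close> of \<open>B\<close> is the triple
  \<open>(\<alpha>, \<beta>, \<gamma>)\<close> with entries in \<open>{0, 1}\<close>, and \<open>x h + y c\<^sub>1 + z c\<^sub>2\<close> in \<open>N\<close> is \<open>(x, y, z)\<close>
  with \<open>0 \<le> x < 4\<close> and \<open>y, z \<in> {0, 1}\<close>; \<open>c\<^sub>3 = c\<^sub>1 + c\<^sub>2\<close>.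
\<close>

definition grpB :: "(int \<times> int \<times> int) monoid" where
  "grpB = integer_mod_group 2 \<times>\<times> integer_mod_group 2 \<times>\<times> integer_mod_group 2"

definition grpN :: "(int \<times> int \<times> int) monoid" where
  "grpN = integer_mod_group 4 \<times>\<times> integer_mod_group 2 \<times>\<times> integer_mod_group 2"

text \<open>\<open>N\<close> is written additively, with integer multiples.\<close>

abbreviation addN :: "int \<times> int \<times> int \<Rightarrow> int \<times> int \<times> int \<Rightarrow> int \<times> int \<times> int"
    (infixl \<open>+\<^sub>N\<close> 65) where
  "a +\<^sub>N b \<equiv> a \<otimes>\<^bsub>grpN\<^esub> b"

abbreviation smultN :: "int \<Rightarrow> int \<times> int \<times> int \<Rightarrow> int \<times> int \<times> int" (infixr \<open>\<cdot>\<^sub>N\<close> 75) where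
  "k \<cdot>\<^sub>N a \<equiv> a [^]\<^bsub>grpN\<^esub> k"

abbreviation sumN :: "(int \<Rightarrow> int \<times> int \<times> int) \<Rightarrow> int set \<Rightarrow> int \<times> int \<times> int" where
  "sumN \<equiv> finprod grpN"

text \<open>All indices are integers and are read modulo 3.\<close>

definition genB :: "int \<Rightarrow> int \<times> int \<times> int" where
  "genB i = (if i mod 3 = 1 then (1, 0, 0) else if i mod 3 = 2 then (0, 1, 0) else (0, 0, 1))"

definition expo :: "int \<times> int \<times> int \<Rightarrow> int \<Rightarrow> int" where
  "expo u i = (case u of (\<alpha>, \<beta>, \<gamma>) \<Rightarrow>
     if i mod 3 = 1 then \<alpha> else if i mod 3 = 2 then \<beta> else \<gamma>)"

definition hN :: "int \<times> int \<times> int" where "hN = (1, 0, 0)"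

definition dN :: "int \<times> int \<times> int" where "dN = 2 \<cdot>\<^sub>N hN"

definition cN :: "int \<Rightarrow> int \<times> int \<times> int" where
  "cN i = (if i mod 3 = 1 then (0, 1, 0) else if i mod 3 = 2 then (0, 0, 1) else (0, 1, 1))"

text \<open>
  The automorphism \<open>e\<^sub>i\<close>, obtained by additive extension from the images of \<open>h\<close>, \<open>c\<^sub>1\<close>, \<open>c\<^sub>2\<close>.
\<close>

definition gen_act :: "int \<Rightarrow> int \<times> int \<times> int \<Rightarrow> int \<times> int \<times> int" where
  "gen_act i a = (case a of (x, y, z) \<Rightarrow>
     x \<cdot>\<^sub>N (hN +\<^sub>N dN)
     +\<^sub>N y \<cdot>\<^sub>N (if i mod 3 = 1 then cN 1 else cN 1 +\<^sub>N dN)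
     +\<^sub>N z \<cdot>\<^sub>N (if i mod 3 = 2 then cN 2 else cN 2 +\<^sub>N dN))"

definition actN :: "int \<times> int \<times> int \<Rightarrow> int \<times> int \<times> int \<Rightarrow> int \<times> int \<times> int" where
  "actN u = (gen_act 1 ^^ nat (expo u 1)) \<circ> (gen_act 2 ^^ nat (expo u 2))
              \<circ> (gen_act 3 ^^ nat (expo u 3))"

definition eta :: "int \<times> int \<times> int \<Rightarrow> int \<times> int \<times> int \<Rightarrow> int \<times> int \<times> int" where
  "eta u v = (let \<alpha> = expo u; \<beta> = expo v in
     sumN (\<lambda>i. (\<alpha> i * \<beta> (i - 1)) \<cdot>\<^sub>N hN) {1, 2, 3}
     +\<^sub>N sumN (\<lambda>i. (\<alpha> i * \<beta> i + \<alpha> (i - 1) * \<beta> (i + 1)) \<cdot>\<^sub>N cN i) {1, 2, 3})"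

definition delta :: "int \<times> int \<times> int \<Rightarrow> int \<times> int \<times> int \<Rightarrow> int" where
  "delta u v = (let \<alpha> = expo u; \<beta> = expo v in
     ((\<Sum>i\<in>{1, 2, 3}. \<alpha> i * \<alpha> (i + 1) * \<beta> i)
      + (\<Sum>i\<in>{1, 2, 3}. (\<alpha> i + \<alpha> (i - 1)) * \<beta> i * \<beta> (i + 1))) mod 2)"

definition theta :: "int \<times> int \<times> int \<Rightarrow> int \<times> int \<times> int \<Rightarrow> int \<times> int \<times> int" where
  "theta u v = eta u v +\<^sub>N delta u v \<cdot>\<^sub>N dN"

definition loopQ :: "((int \<times> int \<times> int) \<times> (int \<times> int \<times> int)) monoid" where
  "loopQ = \<lparr>carrier = carrier grpB \<times> carrier grpN,
            mult = (\<lambda>(u, a) (v, b). (u \<otimes>\<^bsub>grpB\<^esub> v, theta u v +\<^sub>N actN v a +\<^sub>N b)),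
            one = (\<one>\<^bsub>grpB\<^esub>, \<one>\<^bsub>grpN\<^esub>)\<rparr>"


subsection \<open>The prescribed action on generators\<close>

lemma comm_group_grpN: "comm_group grpN"
proof -
  have "group grpN"
    by (simp add: grpN_def DirProd_group)
  then show ?thesis
    by (rule group.group_comm_groupI) (auto simp: grpN_def add.commute)
qed

lemma carrier_grpB: "carrier grpB = {0, 1} \<times> {0, 1} \<times> {0, 1}"
proof -
  have "{0..<2} = {0, 1::int}"
    by force
  then show ?thesis
    by (simp add: grpB_def carrier_integer_mod_group)
qed

lemma carrier_grpN: "carrier grpN = {0, 1, 2, 3} \<times> {0, 1} \<times> {0, 1}"
proof -
  have "{0..<2} = {0, 1::int}" "{0..<4} = {0, 1, 2, 3::int}"
    by force+
  then show ?thesis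
    by (simp add: grpN_def carrier_integer_mod_group)
qed

lemma mult_grpB:
  "(x, y, z) \<otimes>\<^bsub>grpB\<^esub> (x', y', z') = ((x + x') mod 2, (y + y') mod 2, (z + z') mod 2)"
  by (simp add: grpB_def)

lemma add_grpN: "(x, y, z) +\<^sub>N (x', y', z') = ((x + x') mod 4, (y + y') mod 2, (z + z') mod 2)"
  by (simp add: grpN_def)

lemma one_grpN: "\<one>\<^bsub>grpN\<^esub> = (0, 0, 0)"
  by (simp add: grpN_def)

lemma nat_pow_grpN:
  "(x, y, z) [^]\<^bsub>grpN\<^esub> (n::nat) = (int n * x mod 4, int n * y mod 2, int n * z mod 2)"
  by (induction n)
    (simp_all add: grpN_def mod_add_left_eq distrib_right
      add.commute[of x] add.commute[of y] add.commute[of z])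

lemma inv_grpN:
  assumes "(x, y, z) \<in> carrier grpN"
  shows "inv\<^bsub>grpN\<^esub> (x, y, z) = (- x mod 4, - y mod 2, - z mod 2)"
  using assms by (simp add: grpN_def inv_DirProd DirProd_group)

lemma smult_grpN: "k \<cdot>\<^sub>N (x, y, z) = (k * x mod 4, k * y mod 2, k * z mod 2)"
proof (cases "k \<ge> 0")
  case True
  then show ?thesis
    by (simp add: int_pow_def2 nat_pow_grpN)
next
  case False
  have "(- (k * x) mod 4, - (k * y) mod 2, - (k * z) mod 2) \<in> carrier grpN"
    by (simp add: grpN_def carrier_integer_mod_group)
  from inv_grpN[OF this] False show ?thesis
    by (simp add: int_pow_def2 nat_pow_grpN mod_minus_eq)
qed

lemma cN_3: "cN 3 = cN 1 +\<^sub>N cN 2"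
  by (simp add: cN_def add_grpN)

lemma gen_act_hN: "gen_act i hN = hN +\<^sub>N dN"
  by (simp add: gen_act_def hN_def dN_def cN_def add_grpN smult_grpN one_grpN)

lemma gen_act_cN:
  assumes "i \<in> {1, 2, 3}" and "j \<in> {1, 2, 3}"
  shows "gen_act i (cN j) = (if i = j then cN j else cN j +\<^sub>N dN)"
  using assms by (auto simp: gen_act_def hN_def dN_def cN_def add_grpN smult_grpN one_grpN)

lemma actN_genB:
  assumes "i \<in> {1, 2, 3}"
  shows "actN (genB i) = gen_act i"
  using assms by (auto simp: actN_def genB_def expo_def)

lemma gen_act_eq:
  assumes "i \<in> {1, 2, 3}"
  shows "gen_act i (x, y, z) =
    ((3 * x + (if i = 1 then 0 else 2 * y) + (if i = 2 then 0 else 2 * z)) mod 4,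
     y mod 2, z mod 2)"
  using assms
  by (elim insertE; simp add: gen_act_def hN_def dN_def cN_def add_grpN smult_grpN one_grpN mod_simps
        mult.commute)

lemma mod_4_eqs:
  fixes a b c x y :: int
  shows "(a + 2 * (y mod 2)) mod 4 = (a + 2 * y) mod 4"
    and "(a + 2 * (y mod 2) + b) mod 4 = (a + 2 * y + b) mod 4"
    and "(3 * (x mod 4) + b) mod 4 = (3 * x + b) mod 4"
    and "(3 * (x mod 4) + b + c) mod 4 = (3 * x + b + c) mod 4"
proof -
  have *: "2 * (y mod 2) = (2 * y) mod 4" by presburger
  have ac: "a + t + b = a + b + t" for t by simp
  from * show "(a + 2 * (y mod 2)) mod 4 = (a + 2 * y) mod 4"
    by (simp only: mod_simps)
  from * show "(a + 2 * (y mod 2) + b) mod 4 = (a + 2 * y + b) mod 4"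
    by (simp only: ac mod_simps)
  have **: "(3 * (x mod 4) + t) mod 4 = (3 * x + t) mod 4" for t
    by (metis mod_add_left_eq mod_mult_right_eq)
  show "(3 * (x mod 4) + b) mod 4 = (3 * x + b) mod 4"
    by (rule **)
  show "(3 * (x mod 4) + b + c) mod 4 = (3 * x + b + c) mod 4"
    using **[of "b + c"] by (simp only: add.assoc)
qed

lemma gen_act_add:
  assumes "i \<in> {1, 2, 3}"
  shows "gen_act i (a +\<^sub>N b) = gen_act i a +\<^sub>N gen_act i b"
proof -
  obtain x y z x' y' z' where ab: "a = (x, y, z)" "b = (x', y', z')"
    by (cases a, cases b) auto
  have "gen_act i (a +\<^sub>N b) =
      ((3 * (x + x') + (if i = 1 then 0 else 2 * (y + y'))
         + (if i = 2 then 0 else 2 * (z + z'))) mod 4,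
       (y + y') mod 2, (z + z') mod 2)"
    using assms unfolding ab
    by (elim insertE; simp add: gen_act_eq add_grpN mod_4_eqs)
  also have "\<dots> = gen_act i a +\<^sub>N gen_act i b"
    using assms unfolding ab
    by (elim insertE; simp add: gen_act_eq add_grpN mod_add_eq;
        simp add: add.assoc add.left_commute)
  finally show ?thesis .
qed

lemma gen_act_closed: "i \<in> {1, 2, 3} \<Longrightarrow> gen_act i a \<in> carrier grpN"
  by (cases a) (simp add: gen_act_eq grpN_def carrier_integer_mod_group)

lemma gen_act_commute:
  assumes "i \<in> {1, 2, 3}" and "j \<in> {1, 2, 3}"
  shows "gen_act i (gen_act j a) = gen_act j (gen_act i a)"
proof -
  obtain x y z where a: "a = (x, y, z)"
    by (cases a)
  show ?thesis
    using assms unfolding a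
    by (elim insertE; simp add: gen_act_eq mod_4_eqs; simp only: mod_eq_dvd_iff; presburger)
qed

lemma gen_act_involution:
  assumes "i \<in> {1, 2, 3}" and "a \<in> carrier grpN"
  shows "gen_act i (gen_act i a) = a"
  using assms by (auto simp: carrier_grpN gen_act_eq)

lemma actN_closed: "a \<in> carrier grpN \<Longrightarrow> actN u a \<in> carrier grpN"
proof -
  have "(gen_act i ^^ n) b \<in> carrier grpN" if "i \<in> {1, 2, 3}" "b \<in> carrier grpN" for i n b
    using that by (induction n) (auto intro: gen_act_closed)
  then show "a \<in> carrier grpN \<Longrightarrow> actN u a \<in> carrier grpN"
    by (simp add: actN_def)
qed

lemma actN_add: "actN u (a +\<^sub>N b) = actN u a +\<^sub>N actN u b"
proof -
  have "(gen_act i ^^ n) (a +\<^sub>N b) = (gen_act i ^^ n) a +\<^sub>N (gen_act i ^^ n) b"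
    if "i \<in> {1, 2, 3}" for i n a b
    using that by (induction n) (auto simp: gen_act_add)
  then show ?thesis
    by (simp add: actN_def)
qed

lemma actN_one: "actN \<one>\<^bsub>grpB\<^esub> a = a"
  by (simp add: actN_def expo_def grpB_def)

lemma actN_mult:
  assumes "u \<in> carrier grpB" and "v \<in> carrier grpB" and "a \<in> carrier grpN"
  shows "actN (u \<otimes>\<^bsub>grpB\<^esub> v) a = actN u (actN v a)"
proof -
  note comm = gen_act_commute[of 2 1] gen_act_commute[of 3 1] gen_act_commute[of 3 2]
  have inv: "gen_act 1 (gen_act 1 b) = b" "gen_act 2 (gen_act 2 b) = b"
    "gen_act 3 (gen_act 3 b) = b" if "b \<in> carrier grpN" for b
    using that by (simp_all add: gen_act_involution)
  have cl: "gen_act 1 b \<in> carrier grpN" "gen_act 2 b \<in> carrier grpN"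
    "gen_act 3 b \<in> carrier grpN" for b
    by (simp_all add: gen_act_closed)
  show ?thesis
    using assms(1,2)
    by (auto simp: carrier_grpB actN_def expo_def mult_grpB comm inv cl assms(3))
qed

end

theory Submission
  imports Defs
begin

text \<open>
  The loop \<open>Q\<close> is an extension of the elementary abelian group \<open>B\<close> by the abelian group \<open>N\<close>, and
  everything about it can be read off from three forms on \<open>B\<close>, seen as a vector space with
  coordinates \<open>u\<^sub>1, u\<^sub>2, u\<^sub>3\<close> over the field of two elements.

  Since \<open>B\<close> acts on \<open>N\<close> by automorphisms, \<open>(xy)z\<close> and \<open>x(yz)\<close> differ only by the failure of
  \<open>\<theta>\<close> to be a cocycle.  This failure is a multiple of \<open>d\<close>, namely \<open>f(u,v,w) d\<close> for the
  trilinear form \<open>f(u,v,w) = u\<^sub>1v\<^sub>2w\<^sub>3 + u\<^sub>2v\<^sub>3w\<^sub>1 + u\<^sub>3v\<^sub>1w\<^sub>2\<close> (\<open>cocycle_defect\<close>,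
  \<open>associator\<close>).  As \<open>(1,d)\<close> is central, \<open>x \ (xy\<cdot>z)\<close> and \<open>(y\<cdot>zx) / x\<close> are \<open>yz\<close> times the
  powers of \<open>(1,d)\<close> with exponents \<open>f(u,v,w)\<close> and \<open>f(v,w,u)\<close>, so that the Buchsteiner law says
  that \<open>f\<close> is invariant under cyclic shifts.  In a conjugacy closed loop \<open>f\<close> would also be
  symmetric in its first two arguments, which it is not.  The form is nondegenerate, so that the
  nucleus is \<open>1 \<times> N\<close>, and it is not zero, so that \<open>A(Q)\<close> is generated by \<open>(1,d)\<close>.

  Modulo \<open>d\<close> the action of \<open>B\<close> on \<open>N\<close> is trivial and \<open>\<theta>\<close> becomes a bilinear map \<open>\<theta>'\<close> from \<open>B\<close>
  to \<open>N/\<langle>d\<rangle>\<close>.  Commutators modulo the centre are therefore the values of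
  \<open>[u,v] = \<theta>'(u,v) - \<theta>'(v,u)\<close>.  The map \<open>[ , ]\<close> has trivial radical, so that the centre of
  \<open>Q/Z(Q)\<close> is \<open>N(Q)/Z(Q)\<close>; its values include the classes of \<open>h + c\<^sub>1\<close>, \<open>h + c\<^sub>2\<close> and
  \<open>h + c\<^sub>3\<close>, and suitable commutators generate \<open>N\<close>, so that \<open>Q' = 1 \<times> N\<close>.  The upper central
  series is thus \<open>1\<close>, \<open>1 \<times> \<langle>d\<rangle>\<close>, \<open>1 \<times> N\<close>, \<open>Q\<close>.

  For the inner mappings, let \<open>\<lambda>(v,a)\<close> be the bilinear form with \<open>va = a + \<lambda>(v,a) d\<close>.  Every
  element of the multiplication group has the shape \<open>(u,a) \<mapsto> (uw, va + G(u))\<close>, where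
  \<open>G(u) = \<theta>'(wv,u) + \<theta>'(u,v) + b\<close> modulo \<open>d\<close> for some constant \<open>b\<close> (\<open>subgroup_mlt_maps\<close>).  Fixing the
  unit element forces \<open>w = 1\<close> and \<open>b = 0\<close>, so that \<open>G(u) = [v,u]\<close> modulo \<open>d\<close>, and two such maps,
  with parameters \<open>v\<close> and \<open>v'\<close>, commute if and only if \<open>\<lambda>(v,[v',u]) = \<lambda>(v',[v,u])\<close> for all \<open>u\<close>.
  This holds because \<open>\<lambda>(v,[v',u])\<close> is the permanent of the matrix with rows \<open>v, v', u\<close>
  (\<open>act_form_theta_bar\<close>).
\<close>

section \<open>Normal subloops and quotient loops\<close>

context algebraic_loop
begin

lemma left_cancel:
  assumes "x \<in> carrier Q" "y \<in> carrier Q" "z \<in> carrier Q"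
  shows "x \<otimes> y = x \<otimes> z \<longleftrightarrow> y = z"
  using ex1_ldiv[of x "x \<otimes> y"] assms m_closed by metis

lemma right_cancel:
  assumes "x \<in> carrier Q" "y \<in> carrier Q" "z \<in> carrier Q"
  shows "y \<otimes> x = z \<otimes> x \<longleftrightarrow> y = z"
  using ex1_rdiv[of x "y \<otimes> x"] assms m_closed by metis

lemma ldiv_eq: "\<lbrakk>x \<in> carrier Q; z \<in> carrier Q; x \<otimes> z = y\<rbrakk> \<Longrightarrow> ldiv Q x y = z"
  unfolding ldiv_def using left_cancel by (intro the_equality) auto

lemma rdiv_eq: "\<lbrakk>x \<in> carrier Q; z \<in> carrier Q; z \<otimes> x = y\<rbrakk> \<Longrightarrow> rdiv Q y x = z"
  unfolding rdiv_def using right_cancel by (intro the_equality) auto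

text \<open>
  The two associativity conditions in the definition of normality are automatic for a set of
  nuclear elements.
\<close>

lemma normal_subloop_in_nucleus:
  assumes "subloop K Q" and "K \<subseteq> nucleus Q"
    and "\<And>x. x \<in> carrier Q \<Longrightarrow> x <# K = K #> x"
  shows "normal_subloop K Q"
proof -
  have "x <# (y <# K) = (x \<otimes> y) <# K" "(K #> x) #> y = K #> (x \<otimes> y)"
    if "x \<in> carrier Q" "y \<in> carrier Q" for x y
  proof -
    have "x \<otimes> (y \<otimes> k) = (x \<otimes> y) \<otimes> k" "(k \<otimes> x) \<otimes> y = k \<otimes> (x \<otimes> y)" if "k \<in> K" for k
      using assms(2) that \<open>x \<in> carrier Q\<close> \<open>y \<in> carrier Q\<close> unfolding nucleus_def by auto
    then show "x <# (y <# K) = (x \<otimes> y) <# K" "(K #> x) #> y = K #> (x \<otimes> y)"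
      by (simp_all add: l_coset_def r_coset_def)
  qed
  then show ?thesis
    using assms unfolding normal_subloop_def by blast
qed

end

locale normal_subloop_of = algebraic_loop +
  fixes K
  assumes normal: "normal_subloop K Q"
begin

lemma K_sub: "k \<in> K \<Longrightarrow> k \<in> carrier Q"
  using normal unfolding normal_subloop_def subloop_def by blast

lemma K_one: "\<one> \<in> K"
  using normal unfolding normal_subloop_def subloop_def by blast

lemma K_mult: "x \<in> K \<Longrightarrow> y \<in> K \<Longrightarrow> x \<otimes> y \<in> K"
  using normal unfolding normal_subloop_def subloop_def by blast

lemma lcos_eq_rcos: "x \<in> carrier Q \<Longrightarrow> x <# K = K #> x"
  using normal unfolding normal_subloop_def by blast

lemma lcos_assoc: "x \<in> carrier Q \<Longrightarrow> y \<in> carrier Q \<Longrightarrow> x <# (y <# K) = (x \<otimes> y) <# K"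
  using normal unfolding normal_subloop_def by blast

lemma rcos_assoc: "x \<in> carrier Q \<Longrightarrow> y \<in> carrier Q \<Longrightarrow> (K #> x) #> y = K #> (x \<otimes> y)"
  using normal unfolding normal_subloop_def by blast

lemma rcos_self: "x \<in> carrier Q \<Longrightarrow> x \<in> K #> x"
  using K_one l_one by (force simp: r_coset_def)

text \<open>
  The inclusion of \<open>K\<close> in \<open>Kk\<close> is where closure of a subloop under right division enters;
  with it, cosets of \<open>K\<close> behave as in a group.
\<close>

lemma rcos_absorb:
  assumes "k \<in> K"
  shows "K #> k = K"
proof
  show "K #> k \<subseteq> K"
    using assms K_mult by (auto simp: r_coset_def)
  show "K \<subseteq> K #> k"
  proof
    fix y assume y: "y \<in> K"
    obtain z where z: "z \<in> carrier Q" "z \<otimes> k = y"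
      using ex1_rdiv[of k y] assms y K_sub by blast
    have "rdiv Q y k = z"
      using z assms by (intro rdiv_eq) (auto simp: K_sub)
    moreover have "rdiv Q y k \<in> K"
      using assms y normal unfolding normal_subloop_def subloop_def by blast
    ultimately show "y \<in> K #> k"
      using z(2) unfolding r_coset_def by force
  qed
qed

lemma rcos_eq_iff:
  assumes "x \<in> carrier Q" "y \<in> carrier Q"
  shows "K #> x = K #> y \<longleftrightarrow> x \<in> K #> y"
proof
  show "K #> x = K #> y \<Longrightarrow> x \<in> K #> y"
    using rcos_self assms by blast
  assume "x \<in> K #> y"
  then obtain k where k: "k \<in> K" "x = k \<otimes> y"
    by (auto simp: r_coset_def)
  have "K #> x = (K #> k) #> y"
    using k assms by (simp add: rcos_assoc K_sub)
  then show "K #> x = K #> y"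
    using k by (simp add: rcos_absorb)
qed

text \<open>
  Detects membership in \<open>K\<close> of a right factor; applied to an associator or a commutator, it
  shows that a normal subloop with associative or commutative quotient contains that element.
\<close>

lemma rcos_mult_right_iff:
  assumes "x \<in> carrier Q" "y \<in> carrier Q"
  shows "K #> (x \<otimes> y) = K #> x \<longleftrightarrow> y \<in> K"
proof -
  have "K #> (x \<otimes> y) = K #> x \<longleftrightarrow> x \<otimes> y \<in> x <# K"
    using assms by (simp add: rcos_eq_iff m_closed lcos_eq_rcos)
  also have "\<dots> \<longleftrightarrow> y \<in> K"
    using assms left_cancel K_sub by (auto simp: l_coset_def)
  finally show ?thesis .
qed

text \<open>
  By normality \<open>(Kx)w = K(xw)\<close> for every \<open>w\<close> in \<open>Ky\<close>, and \<open>x(Ky) = x(yK) = (xy)K\<close> shows that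
  \<open>xw\<close> stays in one coset.
\<close>

lemma rcos_sum:
  assumes "x \<in> carrier Q" "y \<in> carrier Q"
  shows "(K #> x) <#> (K #> y) = K #> (x \<otimes> y)"
proof -
  have Ky: "w \<in> carrier Q" if "w \<in> K #> y" for w
    using that assms by (auto simp: r_coset_def K_sub m_closed)
  have "(K #> x) <#> (K #> y) = (\<Union>w\<in>K #> y. (K #> x) #> w)"
    by (auto simp: set_mult_def r_coset_def)
  also have "\<dots> = (\<Union>w\<in>K #> y. K #> (x \<otimes> w))"
    using Ky assms by (simp add: rcos_assoc)
  also have "\<dots> = (\<Union>w\<in>K #> y. K #> (x \<otimes> y))"
  proof (rule SUP_cong[OF refl])
    fix w assume w: "w \<in> K #> y"
    then have "w \<in> y <# K"
      using assms by (simp add: lcos_eq_rcos)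
    then have "x \<otimes> w \<in> x <# (y <# K)"
      by (auto simp: l_coset_def)
    then have "x \<otimes> w \<in> K #> (x \<otimes> y)"
      using lcos_assoc[of x y] lcos_eq_rcos[of "x \<otimes> y"] assms m_closed by simp
    then show "K #> (x \<otimes> w) = K #> (x \<otimes> y)"
      using assms Ky w by (simp add: rcos_eq_iff m_closed)
  qed
  also have "\<dots> = K #> (x \<otimes> y)"
    using rcos_self assms by auto
  finally show ?thesis .
qed

lemma group_Mod_iff:
  "group (Q Mod K) \<longleftrightarrow> (\<forall>x\<in>carrier Q. \<forall>y\<in>carrier Q. \<forall>z\<in>carrier Q.
     K #> ((x \<otimes> y) \<otimes> z) = K #> (x \<otimes> (y \<otimes> z)))" (is "?L \<longleftrightarrow> ?R")
proof
  assume ?L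
  then interpret G: group "Q Mod K" .
  show ?R
  proof (intro ballI)
    fix x y z assume xyz: "x \<in> carrier Q" "y \<in> carrier Q" "z \<in> carrier Q"
    then show "K #> ((x \<otimes> y) \<otimes> z) = K #> (x \<otimes> (y \<otimes> z))"
      using G.m_assoc[of "K #> x" "K #> y" "K #> z"] by (simp add: carrier_FactGroup rcos_sum m_closed)
  qed
next
  assume R: ?R
  have K1: "K #> \<one> = K"
    by (simp add: rcos_absorb K_one)
  show ?L
  proof (rule groupI)
    fix X assume "X \<in> carrier (Q Mod K)"
    then obtain x where x: "x \<in> carrier Q" "X = K #> x"
      by (auto simp: carrier_FactGroup)
    obtain y where "y \<in> carrier Q" "y \<otimes> x = \<one>"
      using ex1_rdiv[of x \<one>] x one_closed by blast
    then have "K #> y \<in> carrier (Q Mod K)" "(K #> y) <#> X = K"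
      using x K1 by (simp_all add: carrier_FactGroup rcos_sum)
    then show "\<exists>Y\<in>carrier (Q Mod K). Y \<otimes>\<^bsub>Q Mod K\<^esub> X = \<one>\<^bsub>Q Mod K\<^esub>"
      by auto
  next
    show "\<one>\<^bsub>Q Mod K\<^esub> \<in> carrier (Q Mod K)"
      using K1 one_closed by (auto simp: carrier_FactGroup)
    show "\<one>\<^bsub>Q Mod K\<^esub> \<otimes>\<^bsub>Q Mod K\<^esub> X = X" if "X \<in> carrier (Q Mod K)" for X
      using that K1 rcos_sum[OF one_closed] by (auto simp: carrier_FactGroup l_one)
  qed (use R in \<open>auto simp: carrier_FactGroup rcos_sum m_closed\<close>)
qed

lemma comm_group_Mod_iff:
  "comm_group (Q Mod K) \<longleftrightarrow> group (Q Mod K) \<and>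
     (\<forall>x\<in>carrier Q. \<forall>y\<in>carrier Q. K #> (x \<otimes> y) = K #> (y \<otimes> x))" (is "?L \<longleftrightarrow> ?R")
proof
  assume ?L
  then interpret G: comm_group "Q Mod K" .
  show ?R
  proof (intro conjI ballI)
    fix x y assume "x \<in> carrier Q" "y \<in> carrier Q"
    then show "K #> (x \<otimes> y) = K #> (y \<otimes> x)"
      using G.m_comm[of "K #> x" "K #> y"] by (simp add: carrier_FactGroup rcos_sum)
  qed (rule G.is_group)
next
  assume R: ?R
  show ?L
    by (rule group.group_comm_groupI) (use R in \<open>auto simp: carrier_FactGroup rcos_sum\<close>)
qed

lemma rcos_in_centre_Mod_iff:
  assumes "x \<in> carrier Q"
  shows "K #> x \<in> centre (Q Mod K) \<longleftrightarrow>
    (\<forall>y\<in>carrier Q. \<forall>z\<in>carrier Q.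
       K #> (x \<otimes> (y \<otimes> z)) = K #> ((x \<otimes> y) \<otimes> z) \<and>
       K #> (y \<otimes> (x \<otimes> z)) = K #> ((y \<otimes> x) \<otimes> z) \<and>
       K #> (y \<otimes> (z \<otimes> x)) = K #> ((y \<otimes> z) \<otimes> x)) \<and>
    (\<forall>y\<in>carrier Q. K #> (x \<otimes> y) = K #> (y \<otimes> x))"
  unfolding centre_def nucleus_def carrier_FactGroup mult_FactGroup
  using assms by (simp add: rcos_sum m_closed)

end

text \<open>
  The definition of the upper central series passes through \<open>Q/{1}\<close>, whose elements are
  singletons rather than elements of \<open>Q\<close>.
\<close>

lemma (in algebraic_loop) upper_central_1: "upper_central Q 1 = centre Q"
proof -
  have "ldiv Q \<one> \<one> = \<one>" "rdiv Q \<one> \<one> = \<one>"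
    by (simp_all add: ldiv_eq rdiv_eq one_closed l_one)
  then have "subloop {\<one>} Q"
    by (simp add: subloop_def one_closed l_one)
  moreover have "{\<one>} \<subseteq> nucleus Q"
    by (simp add: nucleus_def one_closed m_closed l_one r_one)
  moreover have *: "{\<one>} #> x = {x}" "x <# {\<one>} = {x}" if "x \<in> carrier Q" for x
    using that by (simp_all add: r_coset_def l_coset_def l_one r_one)
  ultimately have "normal_subloop {\<one>} Q"
    using normal_subloop_in_nucleus by simp
  then interpret K: normal_subloop_of Q "{\<one>}"
    by unfold_locales
  have "{\<one>} #> x \<in> centre (Q Mod {\<one>}) \<longleftrightarrow> x \<in> centre Q" if "x \<in> carrier Q" for x
    unfolding K.rcos_in_centre_Mod_iff[OF that]
    using that by (auto simp: centre_def nucleus_def * m_closed)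
  moreover have "centre Q \<subseteq> carrier Q"
    by (auto simp: centre_def nucleus_def)
  ultimately show ?thesis
    by auto
qed

section \<open>Translations of a loop\<close>

context algebraic_loop
begin

lemma left_translation_Bij: "x \<in> carrier Q \<Longrightarrow> left_translation Q x \<in> Bij (carrier Q)"
  unfolding left_translation_def Bij_def bij_betw_def inj_on_def
  using ex1_ldiv[of x] by (auto simp: left_cancel m_closed image_iff) metis

text \<open>
  Conjugacy closedness of the left translations, with the inverse translation cleared:
  \<open>L\<^sub>x L\<^sub>y = L\<^sub>w L\<^sub>x\<close>.
\<close>

lemma conjugacy_closed_left:
  assumes "conjugacy_closed_loop Q" and x: "x \<in> carrier Q" and y: "y \<in> carrier Q"
  shows "\<exists>w\<in>carrier Q. \<forall>s\<in>carrier Q. x \<otimes> (y \<otimes> s) = w \<otimes> (x \<otimes> s)"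
proof -
  let ?S = "BijGroup (carrier Q)" and ?L = "left_translation Q"
  interpret S: group ?S
    by (rule group_BijGroup)
  have L: "?L v \<in> carrier ?S" if "v \<in> carrier Q" for v
    using left_translation_Bij[OF that] by (simp add: BijGroup_def)
  obtain w where w: "w \<in> carrier Q" "?L x \<otimes>\<^bsub>?S\<^esub> ?L y \<otimes>\<^bsub>?S\<^esub> inv\<^bsub>?S\<^esub> ?L x = ?L w"
    using assms unfolding conjugacy_closed_loop_def Let_def by blast
  then have "?L x \<otimes>\<^bsub>?S\<^esub> ?L y = ?L w \<otimes>\<^bsub>?S\<^esub> ?L x"
    using L x y S.inv_solve_right[of "?L w" "?L x \<otimes>\<^bsub>?S\<^esub> ?L y" "?L x"] by simp
  then have "compose (carrier Q) (?L x) (?L y) = compose (carrier Q) (?L w) (?L x)"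
    using x y w(1) left_translation_Bij by (simp add: BijGroup_def)
  then have "x \<otimes> (y \<otimes> s) = w \<otimes> (x \<otimes> s)" if "s \<in> carrier Q" for s
    using x y w(1) that m_closed by (auto simp: compose_def left_translation_def dest: fun_cong[of _ _ s])
  then show ?thesis
    using w(1) by blast
qed

end

lemma subgroup_stabilizer:
  assumes "subgroup H (BijGroup A)" and "a \<in> A"
  shows "subgroup {f \<in> H. f a = a} (BijGroup A)"
proof -
  interpret G: group "BijGroup A"
    by (rule group_BijGroup)
  have Bij: "f \<in> Bij A" if "f \<in> H" for f
    using subgroup.subset[OF assms(1)] that by (auto simp: BijGroup_def)
  show ?thesis
  proof (rule G.subgroupI)
    show "{f \<in> H. f a = a} \<subseteq> carrier (BijGroup A)"
      using Bij by (auto simp: BijGroup_def)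
    have "\<one>\<^bsub>BijGroup A\<^esub> \<in> {f \<in> H. f a = a}"
      using subgroup.one_closed[OF assms(1)] assms(2) by (simp add: BijGroup_def)
    then show "{f \<in> H. f a = a} \<noteq> {}"
      by blast
    show "inv\<^bsub>BijGroup A\<^esub> f \<in> {f \<in> H. f a = a}" if "f \<in> {f \<in> H. f a = a}" for f
    proof -
      have f: "f \<in> H" "f a = a" "inj_on f A"
        using that Bij[of f] by (auto simp: Bij_def bij_betw_def)
      then have "inv_into A f a = a"
        using assms(2) by (metis inv_into_f_f)
      then show ?thesis
        using f assms(2) subgroup.m_inv_closed[OF assms(1)] Bij by (simp add: inv_BijGroup)
    qed
    show "f \<otimes>\<^bsub>BijGroup A\<^esub> g \<in> {f \<in> H. f a = a}"
      if "f \<in> {f \<in> H. f a = a}" "g \<in> {f \<in> H. f a = a}" for f g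
    proof -
      have "(f \<otimes>\<^bsub>BijGroup A\<^esub> g) a = a"
        using that Bij assms(2) by (simp add: BijGroup_def compose_eq)
      then show ?thesis
        using that subgroup.m_closed[OF assms(1)] by simp
    qed
  qed
qed

section \<open>The cocycle modulo \<open>d\<close> and its associativity defect\<close>

interpretation B: comm_group grpB
proof -
  have "group grpB"
    by (simp add: grpB_def DirProd_group)
  then show "comm_group grpB"
    by (rule group.group_comm_groupI) (auto simp: grpB_def add.commute)
qed

interpretation N: comm_group grpN
  by (rule comm_group_grpN)

text \<open>
  Finite identities on \<open>B\<close> and \<open>N\<close> are turned into conjunctions of closed numerical statements.
\<close>

lemma Ball_grpB:
  "(\<forall>u\<in>carrier grpB. P u) \<longleftrightarrow>
     P (0, 0, 0) \<and> P (0, 0, 1) \<and> P (0, 1, 0) \<and> P (0, 1, 1) \<and> 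
     P (1, 0, 0) \<and> P (1, 0, 1) \<and> P (1, 1, 0) \<and> P (1, 1, 1)"
  by (auto simp: carrier_grpB)

lemma Ball_grpN:
  "(\<forall>a\<in>carrier grpN. P a) \<longleftrightarrow>
     P (0, 0, 0) \<and> P (0, 0, 1) \<and> P (0, 1, 0) \<and> P (0, 1, 1) \<and> 
     P (1, 0, 0) \<and> P (1, 0, 1) \<and> P (1, 1, 0) \<and> P (1, 1, 1) \<and> 
     P (2, 0, 0) \<and> P (2, 0, 1) \<and> P (2, 1, 0) \<and> P (2, 1, 1) \<and> 
     P (3, 0, 0) \<and> P (3, 0, 1) \<and> P (3, 1, 0) \<and> P (3, 1, 1)"
  by (auto simp: carrier_grpN)

lemma one_grpB: "\<one>\<^bsub>grpB\<^esub> = (0, 0, 0)"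
  by (simp add: grpB_def)

lemma grpB_square: "u \<in> carrier grpB \<Longrightarrow> u \<otimes>\<^bsub>grpB\<^esub> u = \<one>\<^bsub>grpB\<^esub>"
  by (auto simp: carrier_grpB mult_grpB one_grpB)

text \<open>
  The projection of \<open>N\<close> onto \<open>N/\<langle>d\<rangle>\<close>, which is elementary abelian of order eight; its elements
  are represented by the same triples of bits as those of \<open>B\<close>, so that \<open>quot_d\<close> is a homomorphism
  into \<open>grpB\<close>.
\<close>

definition quot_d :: "int \<times> int \<times> int \<Rightarrow> int \<times> int \<times> int" where
  "quot_d a = (case a of (x, y, z) \<Rightarrow> (x mod 2, y mod 2, z mod 2))"

definition d_pow :: "int \<Rightarrow> int \<times> int \<times> int" where
  "d_pow k = k \<cdot>\<^sub>N dN"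

text \<open>
  The form \<open>\<lambda>(v,a)\<close> with \<open>va = a + \<lambda>(v,a) d\<close>, for \<open>a\<close> taken modulo \<open>d\<close>.  Only its parity is
  meaningful, as for \<open>assoc_form\<close> below.
\<close>

definition act_form :: "int \<times> int \<times> int \<Rightarrow> int \<times> int \<times> int \<Rightarrow> int" where
  "act_form v a = (case v of (v1, v2, v3) \<Rightarrow> case a of (x, y, z) \<Rightarrow>
     x * (v1 + v2 + v3) + y * (v2 + v3) + z * (v1 + v3))"

definition assoc_form :: "int \<times> int \<times> int \<Rightarrow> int \<times> int \<times> int \<Rightarrow> int \<times> int \<times> int \<Rightarrow> int" where
  "assoc_form u v w = (case u of (u1, u2, u3) \<Rightarrow> case v of (v1, v2, v3) \<Rightarrow> case w of (w1, w2, w3) \<Rightarrow>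
     u1 * v2 * w3 + u2 * v3 * w1 + u3 * v1 * w2)"

definition theta_bar :: "int \<times> int \<times> int \<Rightarrow> int \<times> int \<times> int \<Rightarrow> int \<times> int \<times> int" where
  "theta_bar u v = quot_d (theta u v)"

lemma d_pow_eq: "d_pow k = (2 * k mod 4, 0, 0)"
  by (simp add: d_pow_def dN_def hN_def smult_grpN mult.commute[of k])

lemma carrier_grpN_iff: "(x, y, z) \<in> carrier grpN \<longleftrightarrow> 0 \<le> x \<and> x < 4 \<and> 0 \<le> y \<and> y < 2 \<and> 0 \<le> z \<and> z < 2"
  by (auto simp: grpN_def carrier_integer_mod_group)

lemma d_pow_closed [simp]: "d_pow k \<in> carrier grpN"
  by (simp add: d_pow_eq carrier_grpN_iff)

text \<open>
  The coordinates of \<open>\<theta>\<close>: the sum of the \<open>c\<^sub>i\<close> is rewritten through \<open>c\<^sub>3 = c\<^sub>1 + c\<^sub>2\<close>, and \<open>\<delta>\<close>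
  enters the first coordinate as \<open>2\<delta>\<close>, where its reduction modulo 2 is absorbed modulo 4.
\<close>

lemma theta_eq:
  "theta (u1, u2, u3) (v1, v2, v3) =
    ((u1 * v3 + u2 * v1 + u3 * v2
      + 2 * (u1 * u2 * v1 + u2 * u3 * v2 + u3 * u1 * v3
        + (u1 + u3) * v1 * v2 + (u2 + u1) * v2 * v3 + (u3 + u2) * v3 * v1)) mod 4,
     (u1 * v1 + u3 * v2 + u3 * v3 + u2 * v1) mod 2,
     (u2 * v2 + u1 * v3 + u3 * v3 + u2 * v1) mod 2)"
proof -
  have sum3: "sumN f {1, 2, 3} = f 1 +\<^sub>N (f 2 +\<^sub>N f 3)" if "\<And>i. f i \<in> carrier grpN" for f
    using that by (simp add: Pi_def)
  have closed: "k \<cdot>\<^sub>N hN \<in> carrier grpN" "k \<cdot>\<^sub>N cN i \<in> carrier grpN" for k i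
    by (simp_all add: hN_def cN_def smult_grpN carrier_grpN_iff)
  have double: "k mod 2 * 2 mod 4 = 2 * k mod 4" for k :: int
    by presburger
  show ?thesis
    unfolding theta_def eta_def delta_def Let_def sum3[OF closed(1)] sum3[OF closed(2)]
    by (simp add: hN_def cN_def dN_def expo_def smult_grpN add_grpN double,
        simp only: mod_add_left_eq mod_add_right_eq, simp add: algebra_simps)
qed


lemma theta_closed [simp]: "theta u v \<in> carrier grpN"
  by (cases u; cases v) (simp add: theta_eq carrier_grpN_iff)

lemma theta_bar_closed [simp]: "theta_bar u v \<in> carrier grpB"
  by (simp add: theta_bar_def quot_d_def grpB_def carrier_integer_mod_group split: prod.split)

lemma quot_d_closed [simp]: "quot_d a \<in> carrier grpB"
  by (simp add: quot_d_def grpB_def carrier_integer_mod_group split: prod.split)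

lemma theta_bar_eq:
  "theta_bar (u1, u2, u3) (v1, v2, v3) =
    ((u1 * v3 + u2 * v1 + u3 * v2) mod 2,
     (u1 * v1 + u3 * v2 + u3 * v3 + u2 * v1) mod 2,
     (u2 * v2 + u1 * v3 + u3 * v3 + u2 * v1) mod 2)"
proof -
  have "(p + 2 * q) mod 4 mod 2 = p mod 2" for p q :: int
    by presburger
  then show ?thesis
    unfolding theta_bar_def quot_d_def theta_eq prod.case by (simp only: mod_mod_trivial)
qed

lemma theta_one [simp]:
  "theta \<one>\<^bsub>grpB\<^esub> v = \<one>\<^bsub>grpN\<^esub>" "theta u \<one>\<^bsub>grpB\<^esub> = \<one>\<^bsub>grpN\<^esub>"
  by (cases v, simp add: theta_eq one_grpB one_grpN, cases u, simp add: theta_eq one_grpB one_grpN)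

lemma quot_d_add: "quot_d (a +\<^sub>N b) = quot_d a \<otimes>\<^bsub>grpB\<^esub> quot_d b"
proof -
  have "(x + y) mod 4 mod 2 = (x mod 2 + y mod 2) mod 2" for x y :: int
    by presburger
  then show ?thesis
    by (cases a, cases b) (simp add: quot_d_def add_grpN mult_grpB mod_simps)
qed

lemma quot_d_d_pow [simp]: "quot_d (d_pow k) = \<one>\<^bsub>grpB\<^esub>"
proof -
  have "2 * k mod 4 mod 2 = 0" by presburger
  then show ?thesis by (simp add: quot_d_def d_pow_eq one_grpB)
qed

lemma quot_d_one [simp]: "quot_d \<one>\<^bsub>grpN\<^esub> = \<one>\<^bsub>grpB\<^esub>"
  by (simp add: quot_d_def one_grpN one_grpB)

lemma quot_d_eq_iff:
  assumes "a \<in> carrier grpN" "b \<in> carrier grpN"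
  shows "quot_d a = quot_d b \<longleftrightarrow> a = b \<or> a = dN +\<^sub>N b"
proof -
  have "\<forall>a\<in>carrier grpN. \<forall>b\<in>carrier grpN. quot_d a = quot_d b \<longleftrightarrow> a = b \<or> a = dN +\<^sub>N b"
    unfolding Ball_grpB Ball_grpN
    by (intro conjI; simp add: quot_d_def dN_def hN_def smult_grpN add_grpN)
  then show ?thesis
    using assms by blast
qed

lemma act_eq:
  assumes "v \<in> carrier grpB" "a \<in> carrier grpN"
  shows "actN v a = a +\<^sub>N d_pow (act_form v (quot_d a))"
proof -
  have "\<forall>v\<in>carrier grpB. \<forall>a\<in>carrier grpN. actN v a = a +\<^sub>N d_pow (act_form v (quot_d a))"
    unfolding Ball_grpB Ball_grpN
    by (intro conjI; simp add: actN_def expo_def gen_act_eq d_pow_eq add_grpN act_form_def quot_d_def)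
  then show ?thesis
    using assms by blast
qed

text \<open>
  The heart of the construction.  Three sources contribute multiples of \<open>d\<close>: the carries in the
  \<open>h\<close>-coordinate of \<open>\<eta>\<close>, the action of \<open>w\<close> on \<open>\<eta>(u,v)\<close>, and the coboundary of \<open>\<delta>\<close>.  All
  three are trilinear, the last one because each summand of \<open>\<delta>\<close> is quadratic in one argument and
  linear in the other, so that its coboundary is a polarization; \<open>\<delta>\<close> is such that the sum of the
  three is the cyclic form \<open>assoc_form\<close>.  The identity is checked
  on all 512 triples.
\<close>

lemma cocycle_defect:
  assumes "u \<in> carrier grpB" "v \<in> carrier grpB" "w \<in> carrier grpB"
  shows "theta (u \<otimes>\<^bsub>grpB\<^esub> v) w +\<^sub>N actN w (theta u v)
    = theta u (v \<otimes>\<^bsub>grpB\<^esub> w) +\<^sub>N theta v w +\<^sub>N d_pow (assoc_form u v w)"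
proof -
  have "\<forall>u\<in>carrier grpB. \<forall>v\<in>carrier grpB. \<forall>w\<in>carrier grpB. theta (u \<otimes>\<^bsub>grpB\<^esub> v) w +\<^sub>N actN w (theta u v)
    = theta u (v \<otimes>\<^bsub>grpB\<^esub> w) +\<^sub>N theta v w +\<^sub>N d_pow (assoc_form u v w)"
    unfolding Ball_grpB
    by (intro conjI; simp add: mult_grpB theta_eq actN_def expo_def gen_act_eq d_pow_eq add_grpN assoc_form_def)
  then show ?thesis
    using assms by blast
qed

text \<open>
  The carries that spoil additivity of \<open>\<theta>\<close> are multiples of \<open>2h = d\<close>, and so are the values of
  \<open>\<delta>d\<close>; modulo \<open>d\<close> a bilinear map remains.
\<close>

lemma theta_bar_mult_left:
  assumes "u \<in> carrier grpB" "v \<in> carrier grpB" "w \<in> carrier grpB"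
  shows "theta_bar (u \<otimes>\<^bsub>grpB\<^esub> v) w = theta_bar u w \<otimes>\<^bsub>grpB\<^esub> theta_bar v w"
proof -
  have "\<forall>u\<in>carrier grpB. \<forall>v\<in>carrier grpB. \<forall>w\<in>carrier grpB. theta_bar (u \<otimes>\<^bsub>grpB\<^esub> v) w = theta_bar u w \<otimes>\<^bsub>grpB\<^esub> theta_bar v w"
    unfolding Ball_grpB
    by (intro conjI; simp add: theta_bar_eq mult_grpB)
  then show ?thesis
    using assms by blast
qed

lemma theta_bar_mult_right:
  assumes "u \<in> carrier grpB" "v \<in> carrier grpB" "w \<in> carrier grpB"
  shows "theta_bar u (v \<otimes>\<^bsub>grpB\<^esub> w) = theta_bar u v \<otimes>\<^bsub>grpB\<^esub> theta_bar u w"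
proof -
  have "\<forall>u\<in>carrier grpB. \<forall>v\<in>carrier grpB. \<forall>w\<in>carrier grpB. theta_bar u (v \<otimes>\<^bsub>grpB\<^esub> w) = theta_bar u v \<otimes>\<^bsub>grpB\<^esub> theta_bar u w"
    unfolding Ball_grpB
    by (intro conjI; simp add: theta_bar_eq mult_grpB)
  then show ?thesis
    using assms by blast
qed

text \<open>
  Both sides are the parity of the permanent of the matrix with rows \<open>u\<close>, \<open>v\<close>, \<open>w\<close>, a symmetric
  function of its rows.
\<close>

lemma act_form_theta_bar:
  assumes "u \<in> carrier grpB" "v \<in> carrier grpB" "w \<in> carrier grpB"
  shows "act_form u (theta_bar v w \<otimes>\<^bsub>grpB\<^esub> theta_bar w v) mod 2
    = act_form v (theta_bar u w \<otimes>\<^bsub>grpB\<^esub> theta_bar w u) mod 2"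
proof -
  have "\<forall>u\<in>carrier grpB. \<forall>v\<in>carrier grpB. \<forall>w\<in>carrier grpB. act_form u (theta_bar v w \<otimes>\<^bsub>grpB\<^esub> theta_bar w v) mod 2
    = act_form v (theta_bar u w \<otimes>\<^bsub>grpB\<^esub> theta_bar w u) mod 2"
    unfolding Ball_grpB
    by (intro conjI; simp add: theta_bar_eq mult_grpB act_form_def)
  then show ?thesis
    using assms by blast
qed

lemma grpB_inv: "u \<in> carrier grpB \<Longrightarrow> inv\<^bsub>grpB\<^esub> u = u"
  by (rule B.inv_equality) (simp_all add: grpB_square)

lemma d_pow_0 [simp]: "d_pow 0 = \<one>\<^bsub>grpN\<^esub>"
  by (simp add: d_pow_def)

lemma d_pow_1: "d_pow 1 = dN"
  by (simp add: d_pow_eq dN_def hN_def smult_grpN)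

lemma d_pow_add: "d_pow j +\<^sub>N d_pow k = d_pow (j + k)"
  by (simp add: d_pow_eq add_grpN mod_simps)

lemma d_pow_eq_iff: "d_pow j = d_pow k \<longleftrightarrow> j mod 2 = k mod 2"
proof -
  have "2 * j mod 4 = 2 * k mod 4 \<longleftrightarrow> j mod 2 = k mod 2"
    by presburger
  then show ?thesis
    by (simp add: d_pow_eq)
qed

lemma act_form_one [simp]: "act_form v \<one>\<^bsub>grpB\<^esub> = 0"
  by (simp add: act_form_def one_grpB split: prod.split)

lemma act_d_pow [simp]: "v \<in> carrier grpB \<Longrightarrow> actN v (d_pow k) = d_pow k"
  by (simp add: act_eq)

lemma act_one [simp]: "v \<in> carrier grpB \<Longrightarrow> actN v \<one>\<^bsub>grpN\<^esub> = \<one>\<^bsub>grpN\<^esub>"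
  by (simp add: act_eq)

lemma act_act [simp]:
  "\<lbrakk>v \<in> carrier grpB; a \<in> carrier grpN\<rbrakk> \<Longrightarrow> actN v (actN v a) = a"
  by (simp add: actN_mult[symmetric] grpB_square actN_one)

lemma quot_d_act [simp]:
  "\<lbrakk>v \<in> carrier grpB; a \<in> carrier grpN\<rbrakk> \<Longrightarrow> quot_d (actN v a) = quot_d a"
  by (simp add: act_eq quot_d_add)

section \<open>Associators and the Buchsteiner law\<close>

lemma mult_loopQ:
  "(u, a) \<otimes>\<^bsub>loopQ\<^esub> (v, b) = (u \<otimes>\<^bsub>grpB\<^esub> v, theta u v +\<^sub>N actN v a +\<^sub>N b)"
  by (simp add: loopQ_def)

lemma carrier_loopQ: "carrier loopQ = carrier grpB \<times> carrier grpN"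
  by (simp add: loopQ_def)

lemma one_loopQ: "\<one>\<^bsub>loopQ\<^esub> = (\<one>\<^bsub>grpB\<^esub>, \<one>\<^bsub>grpN\<^esub>)"
  by (simp add: loopQ_def)

interpretation Q: algebraic_loop loopQ
proof
  show "x \<otimes>\<^bsub>loopQ\<^esub> y \<in> carrier loopQ" if "x \<in> carrier loopQ" "y \<in> carrier loopQ" for x y
    using that by (auto simp: carrier_loopQ mult_loopQ actN_closed)
  show "\<one>\<^bsub>loopQ\<^esub> \<in> carrier loopQ"
    by (simp add: carrier_loopQ one_loopQ)
  show "\<one>\<^bsub>loopQ\<^esub> \<otimes>\<^bsub>loopQ\<^esub> x = x" "x \<otimes>\<^bsub>loopQ\<^esub> \<one>\<^bsub>loopQ\<^esub> = x" if "x \<in> carrier loopQ" for x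
    using that by (auto simp: carrier_loopQ one_loopQ mult_loopQ actN_one)
  fix x y assume "x \<in> carrier loopQ" "y \<in> carrier loopQ"
  then obtain u a w c where xy: "x = (u, a)" "y = (w, c)" and
    [simp]: "u \<in> carrier grpB" "a \<in> carrier grpN" "w \<in> carrier grpB" "c \<in> carrier grpN"
    by (auto simp: carrier_loopQ)
  define v where "v = inv\<^bsub>grpB\<^esub> u \<otimes>\<^bsub>grpB\<^esub> w"
  have v [simp]: "v \<in> carrier grpB"
    by (simp add: v_def)
  have "x \<otimes>\<^bsub>loopQ\<^esub> (v', b) = y \<longleftrightarrow> (v', b) = (v, inv\<^bsub>grpN\<^esub> (theta u v +\<^sub>N actN v a) +\<^sub>N c)"
    if "v' \<in> carrier grpB" "b \<in> carrier grpN" for v' b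
  proof -
    have "x \<otimes>\<^bsub>loopQ\<^esub> (v', b) = y \<longleftrightarrow> v' = v \<and> theta u v +\<^sub>N actN v a +\<^sub>N b = c"
      using that B.inv_solve_left[of v' u w] by (auto simp: xy mult_loopQ v_def)
    also have "theta u v +\<^sub>N actN v a +\<^sub>N b = c \<longleftrightarrow> b = inv\<^bsub>grpN\<^esub> (theta u v +\<^sub>N actN v a) +\<^sub>N c"
      using that N.inv_solve_left[of b "theta u v +\<^sub>N actN v a" c] by (auto simp: actN_closed)
    finally show ?thesis by simp
  qed
  then have "x \<otimes>\<^bsub>loopQ\<^esub> z = y \<longleftrightarrow> z = (v, inv\<^bsub>grpN\<^esub> (theta u v +\<^sub>N actN v a) +\<^sub>N c)"
    if "z \<in> carrier loopQ" for z
    using that by (metis SigmaE carrier_loopQ)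
  moreover have "(v, inv\<^bsub>grpN\<^esub> (theta u v +\<^sub>N actN v a) +\<^sub>N c) \<in> carrier loopQ"
    by (simp add: carrier_loopQ actN_closed)
  ultimately show "\<exists>!z. z \<in> carrier loopQ \<and> x \<otimes>\<^bsub>loopQ\<^esub> z = y"
    by metis
  have "(v', b) \<otimes>\<^bsub>loopQ\<^esub> x = y \<longleftrightarrow>
      (v', b) = (v, actN u (inv\<^bsub>grpN\<^esub> (theta v u) +\<^sub>N (c +\<^sub>N inv\<^bsub>grpN\<^esub> a)))"
    if "v' \<in> carrier grpB" "b \<in> carrier grpN" for v' b
  proof -
    let ?t = "inv\<^bsub>grpN\<^esub> (theta v u) +\<^sub>N (c +\<^sub>N inv\<^bsub>grpN\<^esub> a)"
    have "(v', b) \<otimes>\<^bsub>loopQ\<^esub> x = y \<longleftrightarrow> v' = v \<and> theta v u +\<^sub>N actN u b +\<^sub>N a = c"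
      using that B.inv_solve_left[of v' u w] by (auto simp: xy mult_loopQ v_def B.m_comm)
    also have "theta v u +\<^sub>N actN u b +\<^sub>N a = c \<longleftrightarrow> actN u b = ?t"
      using that N.inv_solve_left[of "actN u b" "theta v u" "c +\<^sub>N inv\<^bsub>grpN\<^esub> a"]
        N.inv_solve_right[of "theta v u +\<^sub>N actN u b" c a]
      by (auto simp: actN_closed)
    also have "\<dots> \<longleftrightarrow> b = actN u ?t"
    proof -
      have "actN u (actN u b) = b" "actN u (actN u ?t) = ?t"
        using that by simp_all
      then show ?thesis by metis
    qed
    finally show ?thesis by simp
  qed
  then have "z \<otimes>\<^bsub>loopQ\<^esub> x = y \<longleftrightarrow> z = (v, actN u (inv\<^bsub>grpN\<^esub> (theta v u) +\<^sub>N (c +\<^sub>N inv\<^bsub>grpN\<^esub> a)))"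
    if "z \<in> carrier loopQ" for z
    using that by (metis SigmaE carrier_loopQ)
  moreover have "(v, actN u (inv\<^bsub>grpN\<^esub> (theta v u) +\<^sub>N (c +\<^sub>N inv\<^bsub>grpN\<^esub> a))) \<in> carrier loopQ"
    by (simp add: carrier_loopQ actN_closed)
  ultimately show "\<exists>!z. z \<in> carrier loopQ \<and> z \<otimes>\<^bsub>loopQ\<^esub> x = y"
    by metis
qed

text \<open>
  The powers of \<open>(1,d)\<close>, which will turn out to form the centre, so that associators can be written
  with the integer-valued form \<open>assoc_form\<close> as exponent.
\<close>

definition z_pow :: "int \<Rightarrow> (int \<times> int \<times> int) \<times> (int \<times> int \<times> int)" where
  "z_pow k = (\<one>\<^bsub>grpB\<^esub>, d_pow k)"

lemma z_pow_closed [simp]: "z_pow k \<in> carrier loopQ"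
  by (simp add: z_pow_def carrier_loopQ)

lemma z_pow_0: "z_pow 0 = \<one>\<^bsub>loopQ\<^esub>"
  by (simp add: z_pow_def one_loopQ)

lemma z_pow_eq_iff: "z_pow j = z_pow k \<longleftrightarrow> j mod 2 = k mod 2"
  by (simp add: z_pow_def d_pow_eq_iff)

lemma mult_z_pow:
  "\<lbrakk>u \<in> carrier grpB; a \<in> carrier grpN\<rbrakk> \<Longrightarrow> (u, a) \<otimes>\<^bsub>loopQ\<^esub> z_pow k = (u, a +\<^sub>N d_pow k)"
  by (simp add: z_pow_def mult_loopQ actN_one)

lemma z_pow_commute:
  "x \<in> carrier loopQ \<Longrightarrow> z_pow k \<otimes>\<^bsub>loopQ\<^esub> x = x \<otimes>\<^bsub>loopQ\<^esub> z_pow k"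
  by (auto simp: carrier_loopQ mult_z_pow) (simp add: z_pow_def mult_loopQ N.m_comm)

lemma z_pow_mult: "z_pow j \<otimes>\<^bsub>loopQ\<^esub> z_pow k = z_pow (j + k)"
  by (simp add: z_pow_def mult_loopQ d_pow_add)

text \<open>
  After the common summands \<open>w(va)\<close>, \<open>wb\<close> and \<open>c\<close> are split off, only the cocycle defect of \<open>\<theta>\<close>
  is left.
\<close>

lemma associator:
  assumes "x \<in> carrier loopQ" "y \<in> carrier loopQ" "z \<in> carrier loopQ"
  shows "(x \<otimes>\<^bsub>loopQ\<^esub> y) \<otimes>\<^bsub>loopQ\<^esub> z
    = (x \<otimes>\<^bsub>loopQ\<^esub> (y \<otimes>\<^bsub>loopQ\<^esub> z)) \<otimes>\<^bsub>loopQ\<^esub> z_pow (assoc_form (fst x) (fst y) (fst z))"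
proof -
  obtain u a v b w c where xyz: "x = (u, a)" "y = (v, b)" "z = (w, c)" and
    [simp]: "u \<in> carrier grpB" "a \<in> carrier grpN" "v \<in> carrier grpB" "b \<in> carrier grpN"
      "w \<in> carrier grpB" "c \<in> carrier grpN"
    using assms by (auto simp: carrier_loopQ)
  let ?k = "assoc_form u v w" and ?abc = "actN w (actN v a) +\<^sub>N (actN w b +\<^sub>N c)"
  note [simp] = actN_closed
  have vw: "actN (v \<otimes>\<^bsub>grpB\<^esub> w) a = actN w (actN v a)"
    by (simp add: B.m_comm[of v w] actN_mult)
  have "snd ((x \<otimes>\<^bsub>loopQ\<^esub> y) \<otimes>\<^bsub>loopQ\<^esub> z)
      = (theta (u \<otimes>\<^bsub>grpB\<^esub> v) w +\<^sub>N actN w (theta u v)) +\<^sub>N ?abc"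
    by (simp add: xyz mult_loopQ actN_add N.m_assoc)
  also have "\<dots> = (theta u (v \<otimes>\<^bsub>grpB\<^esub> w) +\<^sub>N theta v w +\<^sub>N d_pow ?k) +\<^sub>N ?abc"
    by (simp add: cocycle_defect)
  also have "\<dots> = snd (x \<otimes>\<^bsub>loopQ\<^esub> (y \<otimes>\<^bsub>loopQ\<^esub> z)) +\<^sub>N d_pow ?k"
    by (simp add: xyz mult_loopQ vw N.m_ac)
  finally show ?thesis
    by (simp add: xyz mult_loopQ mult_z_pow B.m_assoc)
qed

lemma assoc_form_cyclic: "assoc_form u v w = assoc_form v w u"
  by (simp add: assoc_form_def split: prod.split)

lemma assoc_form_one [simp]:
  "assoc_form \<one>\<^bsub>grpB\<^esub> v w = 0" "assoc_form u \<one>\<^bsub>grpB\<^esub> w = 0" "assoc_form u v \<one>\<^bsub>grpB\<^esub> = 0"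
  by (simp_all add: assoc_form_def one_grpB split: prod.split)

lemma associates_iff:
  assumes "x \<in> carrier loopQ" "y \<in> carrier loopQ" "z \<in> carrier loopQ"
  shows "x \<otimes>\<^bsub>loopQ\<^esub> (y \<otimes>\<^bsub>loopQ\<^esub> z) = (x \<otimes>\<^bsub>loopQ\<^esub> y) \<otimes>\<^bsub>loopQ\<^esub> z
    \<longleftrightarrow> even (assoc_form (fst x) (fst y) (fst z))" (is "?m = _ \<longleftrightarrow> even ?k")
proof -
  have m: "?m \<in> carrier loopQ"
    using assms by (simp add: Q.m_closed)
  have "?m = (x \<otimes>\<^bsub>loopQ\<^esub> y) \<otimes>\<^bsub>loopQ\<^esub> z \<longleftrightarrow> ?m \<otimes>\<^bsub>loopQ\<^esub> z_pow 0 = ?m \<otimes>\<^bsub>loopQ\<^esub> z_pow ?k"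
    using m by (simp add: associator[OF assms] z_pow_0 Q.r_one)
  also have "\<dots> \<longleftrightarrow> even ?k"
    using m by (simp only: Q.left_cancel z_pow_closed z_pow_eq_iff) presburger
  finally show ?thesis .
qed

lemma fst_mult: "fst (x \<otimes>\<^bsub>loopQ\<^esub> y) = fst x \<otimes>\<^bsub>grpB\<^esub> fst y"
  by (cases x, cases y) (simp add: mult_loopQ)

lemma fst_closed [simp]: "x \<in> carrier loopQ \<Longrightarrow> fst x \<in> carrier grpB"
  by (auto simp: carrier_loopQ)

lemma z_pow_fst [simp]: "fst (z_pow k) = \<one>\<^bsub>grpB\<^esub>"
  by (simp add: z_pow_def)

text \<open>
  With \<open>k = f(x,y,z)\<close>, the element \<open>yz\<cdot>(1,d)\<^sup>k\<close> is a solution of both division problems: of the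
  first by the definition of \<open>k\<close>, of the second because also \<open>k = f(y,z,x)\<close>.
\<close>

lemma buchsteiner_loopQ: "buchsteiner_loop loopQ"
  unfolding buchsteiner_loop_def
proof (intro conjI ballI)
  show "algebraic_loop loopQ"
    by (rule Q.algebraic_loop_axioms)
  fix x y z assume [simp]: "x \<in> carrier loopQ" "y \<in> carrier loopQ" "z \<in> carrier loopQ"
  note [simp] = Q.m_closed
  let ?k = "assoc_form (fst x) (fst y) (fst z)"
  let ?t = "(y \<otimes>\<^bsub>loopQ\<^esub> z) \<otimes>\<^bsub>loopQ\<^esub> z_pow ?k"
  have z2: "z_pow (2 * ?k) = \<one>\<^bsub>loopQ\<^esub>"
    by (simp add: z_pow_0[symmetric] z_pow_eq_iff)
  have "x \<otimes>\<^bsub>loopQ\<^esub> ?t = (x \<otimes>\<^bsub>loopQ\<^esub> (y \<otimes>\<^bsub>loopQ\<^esub> z)) \<otimes>\<^bsub>loopQ\<^esub> z_pow ?k"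
    using associates_iff[of x "y \<otimes>\<^bsub>loopQ\<^esub> z" "z_pow ?k"] by simp
  then have 1: "x \<otimes>\<^bsub>loopQ\<^esub> ?t = (x \<otimes>\<^bsub>loopQ\<^esub> y) \<otimes>\<^bsub>loopQ\<^esub> z"
    by (simp add: associator[of x y z])
  have "?t \<otimes>\<^bsub>loopQ\<^esub> x = (y \<otimes>\<^bsub>loopQ\<^esub> z) \<otimes>\<^bsub>loopQ\<^esub> (x \<otimes>\<^bsub>loopQ\<^esub> z_pow ?k)"
    using associates_iff[of "y \<otimes>\<^bsub>loopQ\<^esub> z" "z_pow ?k" x] by (simp add: z_pow_commute)
  also have "\<dots> = ((y \<otimes>\<^bsub>loopQ\<^esub> z) \<otimes>\<^bsub>loopQ\<^esub> x) \<otimes>\<^bsub>loopQ\<^esub> z_pow ?k"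
    using associates_iff[of "y \<otimes>\<^bsub>loopQ\<^esub> z" x "z_pow ?k"] by simp
  also have "\<dots> = ((y \<otimes>\<^bsub>loopQ\<^esub> (z \<otimes>\<^bsub>loopQ\<^esub> x)) \<otimes>\<^bsub>loopQ\<^esub> z_pow ?k) \<otimes>\<^bsub>loopQ\<^esub> z_pow ?k"
    by (simp add: associator[of y z x] assoc_form_cyclic[of "fst x"])
  also have "\<dots> = y \<otimes>\<^bsub>loopQ\<^esub> (z \<otimes>\<^bsub>loopQ\<^esub> x)"
    using associates_iff[of "y \<otimes>\<^bsub>loopQ\<^esub> (z \<otimes>\<^bsub>loopQ\<^esub> x)" "z_pow ?k" "z_pow ?k"]
    by (simp add: z_pow_mult z2 Q.r_one)
  finally have 2: "?t \<otimes>\<^bsub>loopQ\<^esub> x = y \<otimes>\<^bsub>loopQ\<^esub> (z \<otimes>\<^bsub>loopQ\<^esub> x)" .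
  show "ldiv loopQ x (x \<otimes>\<^bsub>loopQ\<^esub> y \<otimes>\<^bsub>loopQ\<^esub> z) = rdiv loopQ (y \<otimes>\<^bsub>loopQ\<^esub> (z \<otimes>\<^bsub>loopQ\<^esub> x)) x"
    using Q.ldiv_eq[OF _ _ 1] Q.rdiv_eq[OF _ _ 2] by simp
qed

text \<open>
  If \<open>L\<^sub>x L\<^sub>y = L\<^sub>w L\<^sub>x\<close>, then \<open>w\<close> lies over the same element of \<open>B\<close> as \<open>y\<close>, so that
  \<open>f(x,y,z) = f(w,x,z) = f(y,x,z)\<close> for all \<open>z\<close>.  On the generators, in the order
  \<open>e\<^sub>1, e\<^sub>2, e\<^sub>3\<close>, the left side is 1 and the right side is 0.
\<close>

lemma not_conjugacy_closed_loopQ: "\<not> conjugacy_closed_loop loopQ"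
proof
  assume cc: "conjugacy_closed_loop loopQ"
  define e where "e i = (genB i, \<one>\<^bsub>grpN\<^esub>)" for i
  define x y z where "x = e 1" and "y = e 2" and "z = e 3"
  have [simp]: "x \<in> carrier loopQ" "y \<in> carrier loopQ" "z \<in> carrier loopQ"
    by (simp_all add: x_def y_def z_def e_def genB_def carrier_loopQ carrier_grpB)
  obtain w where [simp]: "w \<in> carrier loopQ"
    and w: "\<And>s. s \<in> carrier loopQ \<Longrightarrow> x \<otimes>\<^bsub>loopQ\<^esub> (y \<otimes>\<^bsub>loopQ\<^esub> s) = w \<otimes>\<^bsub>loopQ\<^esub> (x \<otimes>\<^bsub>loopQ\<^esub> s)"
    using Q.conjugacy_closed_left[OF cc, of x y] by auto
  have wx: "w \<otimes>\<^bsub>loopQ\<^esub> x = x \<otimes>\<^bsub>loopQ\<^esub> y"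
    using w[OF Q.one_closed] by (simp add: Q.r_one)
  then have "fst w \<otimes>\<^bsub>grpB\<^esub> fst x = fst y \<otimes>\<^bsub>grpB\<^esub> fst x"
    by (metis B.m_comm \<open>x \<in> carrier loopQ\<close> \<open>y \<in> carrier loopQ\<close> fst_closed fst_mult)
  then have fw: "fst w = fst y"
    by simp
  have "(x \<otimes>\<^bsub>loopQ\<^esub> (y \<otimes>\<^bsub>loopQ\<^esub> z)) \<otimes>\<^bsub>loopQ\<^esub> z_pow (assoc_form (fst x) (fst y) (fst z))
      = (x \<otimes>\<^bsub>loopQ\<^esub> (y \<otimes>\<^bsub>loopQ\<^esub> z)) \<otimes>\<^bsub>loopQ\<^esub> z_pow (assoc_form (fst y) (fst x) (fst z))"
    using associator[of x y z] associator[of w x z] wx w[of z] fw by simp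
  then have "z_pow (assoc_form (fst x) (fst y) (fst z)) = z_pow (assoc_form (fst y) (fst x) (fst z))"
    by (simp add: Q.left_cancel Q.m_closed)
  then show False
    by (simp add: x_def y_def z_def e_def genB_def assoc_form_def z_pow_eq_iff)
qed

section \<open>Nucleus and centre\<close>

text \<open>
  The nucleus lies over the radical of \<open>f\<close>, and each coordinate of \<open>u\<close> is a value \<open>f(u,v,w)\<close> at
  two generators \<open>v, w\<close>.
\<close>

lemma nucleus_loopQ: "nucleus loopQ = {\<one>\<^bsub>grpB\<^esub>} \<times> carrier grpN"
proof
  show "{\<one>\<^bsub>grpB\<^esub>} \<times> carrier grpN \<subseteq> nucleus loopQ"
  proof
    fix a assume a: "a \<in> {\<one>\<^bsub>grpB\<^esub>} \<times> carrier grpN"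
    then have "a \<in> carrier loopQ" "fst a = \<one>\<^bsub>grpB\<^esub>"
      by (auto simp: carrier_loopQ)
    then show "a \<in> nucleus loopQ"
      by (simp add: nucleus_def associates_iff)
  qed
  show "nucleus loopQ \<subseteq> {\<one>\<^bsub>grpB\<^esub>} \<times> carrier grpN"
  proof
    fix a assume a: "a \<in> nucleus loopQ"
    then have aQ: "a \<in> carrier loopQ"
      by (simp add: nucleus_def)
    have even: "even (assoc_form (fst a) v w)" if "v \<in> carrier grpB" "w \<in> carrier grpB" for v w
    proof -
      have vw: "(v, \<one>\<^bsub>grpN\<^esub>) \<in> carrier loopQ" "(w, \<one>\<^bsub>grpN\<^esub>) \<in> carrier loopQ"
        using that by (simp_all add: carrier_loopQ)
      then show ?thesis
        using a associates_iff[OF aQ vw] by (simp add: nucleus_def)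
    qed
    obtain u1 u2 u3 n where u: "a = ((u1, u2, u3), n)"
      by (cases a) auto
    have "even u1" "even u2" "even u3"
      using even[of "(0, 1, 0)" "(0, 0, 1)"] even[of "(0, 0, 1)" "(1, 0, 0)"]
        even[of "(1, 0, 0)" "(0, 1, 0)"] by (simp_all add: u carrier_grpB assoc_form_def)
    then show "a \<in> {\<one>\<^bsub>grpB\<^esub>} \<times> carrier grpN"
      using aQ by (auto simp: u carrier_loopQ carrier_grpB one_grpB)
  qed
qed

lemma range_z_pow: "range z_pow = {(\<one>\<^bsub>grpB\<^esub>, \<one>\<^bsub>grpN\<^esub>), (\<one>\<^bsub>grpB\<^esub>, dN)}"
proof -
  have "z_pow k = z_pow 0 \<or> z_pow k = z_pow 1" for k
    by (simp add: z_pow_eq_iff) presburger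
  then have "range z_pow = {z_pow 0, z_pow 1}"
    by blast
  then show ?thesis
    by (simp add: z_pow_def d_pow_1)
qed

text \<open>
  A nuclear element \<open>(1,n)\<close> is central if and only if \<open>B\<close> fixes \<open>n\<close>, that is, if and only if
  \<open>\<lambda>(u,n) = 0\<close> for every generator \<open>u\<close>; these three equations say that \<open>n\<close> is 0 modulo \<open>d\<close>.
\<close>

lemma centre_loopQ: "centre loopQ = range z_pow"
proof
  show "range z_pow \<subseteq> centre loopQ"
    by (auto simp: centre_def nucleus_loopQ z_pow_commute) (simp_all add: z_pow_def)
  show "centre loopQ \<subseteq> range z_pow"
  proof
    fix a assume a: "a \<in> centre loopQ"
    then obtain n where n: "a = (\<one>\<^bsub>grpB\<^esub>, n)" "n \<in> carrier grpN"
      by (auto simp: centre_def nucleus_loopQ)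
    have even: "even (act_form u (quot_d n))" if "u \<in> carrier grpB" for u
    proof -
      have "a \<otimes>\<^bsub>loopQ\<^esub> (u, \<one>\<^bsub>grpN\<^esub>) = (u, \<one>\<^bsub>grpN\<^esub>) \<otimes>\<^bsub>loopQ\<^esub> a"
        using a that by (simp add: centre_def carrier_loopQ)
      then have "n +\<^sub>N d_pow (act_form u (quot_d n)) = n"
        using that n by (simp add: mult_loopQ act_eq[of u n] actN_one)
      then have "d_pow (act_form u (quot_d n)) = d_pow 0"
        using n by (simp add: N.l_cancel_one)
      then show ?thesis
        unfolding d_pow_eq_iff by presburger
    qed
    obtain x y z where xyz: "n = (x, y, z)"
      by (cases n)
    have "even (x mod 2 + (y mod 2 + z mod 2))" "even (x mod 2 + y mod 2)" "even (x mod 2 + z mod 2)"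
      using even[of "(1, 0, 0)"] even[of "(0, 1, 0)"] even[of "(0, 0, 1)"]
      by (simp_all add: carrier_grpB act_form_def quot_d_def xyz)
    then have "quot_d n = quot_d \<one>\<^bsub>grpN\<^esub>"
      by (simp add: quot_d_def xyz one_grpN)
    then show "a \<in> range z_pow"
      using quot_d_eq_iff[of n "\<one>\<^bsub>grpN\<^esub>"] n N.r_one[of dN] d_pow_closed[of 1]
      by (auto simp: range_z_pow d_pow_1)
  qed
qed

section \<open>Quotients and central series\<close>

lemma rcos_centre_eq_iff:
  assumes "x \<in> carrier loopQ" "y \<in> carrier loopQ"
  shows "x \<in> range z_pow #>\<^bsub>loopQ\<^esub> y \<longleftrightarrow> fst x = fst y \<and> quot_d (snd x) = quot_d (snd y)"
proof -
  have "x \<in> range z_pow #>\<^bsub>loopQ\<^esub> y \<longleftrightarrow> x = z_pow 0 \<otimes>\<^bsub>loopQ\<^esub> y \<or> x = z_pow 1 \<otimes>\<^bsub>loopQ\<^esub> y"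
    by (auto simp: r_coset_def range_z_pow) (auto simp: z_pow_def d_pow_1)
  also have "\<dots> \<longleftrightarrow> fst x = fst y \<and> quot_d (snd x) = quot_d (snd y)"
    using assms quot_d_eq_iff[of "snd x" "snd y"]
    by (auto simp: z_pow_def mult_loopQ carrier_loopQ actN_one d_pow_1[symmetric] actN_closed act_eq)
  finally show ?thesis .
qed

lemma normal_centre: "normal_subloop (range z_pow) loopQ"
proof (rule Q.normal_subloop_in_nucleus)
  show "range z_pow \<subseteq> nucleus loopQ"
    by (auto simp: nucleus_loopQ z_pow_def)
  have "ldiv loopQ (z_pow j) (z_pow k) = z_pow (k - j)" "rdiv loopQ (z_pow j) (z_pow k) = z_pow (j - k)" for j k
    by (simp_all add: Q.ldiv_eq Q.rdiv_eq z_pow_mult)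
  then show "subloop (range z_pow) loopQ"
    by (auto simp: subloop_def z_pow_mult z_pow_0[symmetric])
  show "x <#\<^bsub>loopQ\<^esub> range z_pow = range z_pow #>\<^bsub>loopQ\<^esub> x" if "x \<in> carrier loopQ" for x
    using z_pow_commute[OF that] by (auto simp: l_coset_def r_coset_def)
qed

interpretation QZ: normal_subloop_of loopQ "range z_pow"
  by unfold_locales (rule normal_centre)

abbreviation kerN :: "((int \<times> int \<times> int) \<times> (int \<times> int \<times> int)) set" where
  "kerN \<equiv> {\<one>\<^bsub>grpB\<^esub>} \<times> carrier grpN"

lemma rcos_kerN:
  assumes "x \<in> carrier loopQ"
  shows "kerN #>\<^bsub>loopQ\<^esub> x = {fst x} \<times> carrier grpN" "x <#\<^bsub>loopQ\<^esub> kerN = {fst x} \<times> carrier grpN"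
proof -
  obtain u a where x: "x = (u, a)" and [simp]: "u \<in> carrier grpB" "a \<in> carrier grpN"
    using assms by (auto simp: carrier_loopQ)
  have mult: "(\<one>\<^bsub>grpB\<^esub>, n) \<otimes>\<^bsub>loopQ\<^esub> x = (u, actN u n +\<^sub>N a)" "x \<otimes>\<^bsub>loopQ\<^esub> (\<one>\<^bsub>grpB\<^esub>, n) = (u, a +\<^sub>N n)"
    if "n \<in> carrier grpN" for n
    using that by (simp_all add: x mult_loopQ actN_closed actN_one)
  have "(\<lambda>n. actN u n +\<^sub>N a) ` carrier grpN = carrier grpN" (is "?f ` _ = _")
  proof
    show "carrier grpN \<subseteq> ?f ` carrier grpN"
    proof
      fix b assume "b \<in> carrier grpN"
      then show "b \<in> ?f ` carrier grpN"
        by (intro image_eqI[of _ _ "actN u (b +\<^sub>N inv\<^bsub>grpN\<^esub> a)"]) (simp_all add: actN_closed N.m_assoc)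
    qed
  qed (rule image_subsetI, simp add: actN_closed)
  moreover have "kerN #>\<^bsub>loopQ\<^esub> x = Pair u ` ?f ` carrier grpN"
    unfolding r_coset_def using mult(1) by force
  ultimately show "kerN #>\<^bsub>loopQ\<^esub> x = {fst x} \<times> carrier grpN"
    by (auto simp: x)
  have "(\<lambda>n. a +\<^sub>N n) ` carrier grpN = carrier grpN" (is "?g ` _ = _")
  proof
    show "carrier grpN \<subseteq> ?g ` carrier grpN"
    proof
      fix b assume "b \<in> carrier grpN"
      then show "b \<in> ?g ` carrier grpN"
        by (intro image_eqI[of _ _ "inv\<^bsub>grpN\<^esub> a +\<^sub>N b"]) (simp_all add: N.m_assoc[symmetric])
    qed
  qed (rule image_subsetI, simp)
  moreover have "x <#\<^bsub>loopQ\<^esub> kerN = Pair u ` ?g ` carrier grpN"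
    unfolding l_coset_def using mult(2) by force
  ultimately show "x <#\<^bsub>loopQ\<^esub> kerN = {fst x} \<times> carrier grpN"
    by (auto simp: x)
qed

lemma normal_kerN: "normal_subloop kerN loopQ"
proof (rule Q.normal_subloop_in_nucleus)
  show "kerN \<subseteq> nucleus loopQ"
    by (simp add: nucleus_loopQ)
  show "x <#\<^bsub>loopQ\<^esub> kerN = kerN #>\<^bsub>loopQ\<^esub> x" if "x \<in> carrier loopQ" for x
    using that by (simp add: rcos_kerN)
  have mult: "(\<one>\<^bsub>grpB\<^esub>, a) \<otimes>\<^bsub>loopQ\<^esub> (\<one>\<^bsub>grpB\<^esub>, b) = (\<one>\<^bsub>grpB\<^esub>, a +\<^sub>N b)"
    if "a \<in> carrier grpN" "b \<in> carrier grpN" for a b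
    using that by (simp add: mult_loopQ actN_one)
  have "ldiv loopQ (\<one>\<^bsub>grpB\<^esub>, a) (\<one>\<^bsub>grpB\<^esub>, b) = (\<one>\<^bsub>grpB\<^esub>, inv\<^bsub>grpN\<^esub> a +\<^sub>N b)"
    "rdiv loopQ (\<one>\<^bsub>grpB\<^esub>, a) (\<one>\<^bsub>grpB\<^esub>, b) = (\<one>\<^bsub>grpB\<^esub>, a +\<^sub>N inv\<^bsub>grpN\<^esub> b)"
    if "a \<in> carrier grpN" "b \<in> carrier grpN" for a b
    using that
    by (auto intro!: Q.ldiv_eq Q.rdiv_eq simp: carrier_loopQ mult N.m_assoc N.m_assoc[symmetric])
  then show "subloop kerN loopQ"
    by (auto simp: subloop_def one_loopQ carrier_loopQ mult)
qed

interpretation QN: normal_subloop_of loopQ kerN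
  by unfold_locales (rule normal_kerN)

lemma rcos_centre_assoc:
  assumes "x \<in> carrier loopQ" "y \<in> carrier loopQ" "z \<in> carrier loopQ"
  shows "range z_pow #>\<^bsub>loopQ\<^esub> (x \<otimes>\<^bsub>loopQ\<^esub> (y \<otimes>\<^bsub>loopQ\<^esub> z)) = range z_pow #>\<^bsub>loopQ\<^esub> ((x \<otimes>\<^bsub>loopQ\<^esub> y) \<otimes>\<^bsub>loopQ\<^esub> z)"
  using assms QZ.rcos_mult_right_iff[of "x \<otimes>\<^bsub>loopQ\<^esub> (y \<otimes>\<^bsub>loopQ\<^esub> z)" "z_pow (assoc_form (fst x) (fst y) (fst z))"]
  by (simp add: associator[of x y z] Q.m_closed)

text \<open>
  All associators vanish in \<open>Q/Z(Q)\<close>, so that only commutation matters there; \<open>x\<close> and \<open>y\<close>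
  commute modulo the centre if and only if \<open>[u,v] = 0\<close> for their components in \<open>B\<close>, and the
  radical of \<open>[ , ]\<close> is trivial.
\<close>

lemma centre_Mod_centre_iff:
  assumes "x \<in> carrier loopQ"
  shows "range z_pow #>\<^bsub>loopQ\<^esub> x \<in> centre (loopQ Mod range z_pow) \<longleftrightarrow> x \<in> kerN"
proof -
  have comm: "range z_pow #>\<^bsub>loopQ\<^esub> (x \<otimes>\<^bsub>loopQ\<^esub> y) = range z_pow #>\<^bsub>loopQ\<^esub> (y \<otimes>\<^bsub>loopQ\<^esub> x)
      \<longleftrightarrow> theta_bar (fst x) (fst y) = theta_bar (fst y) (fst x)" if y_in: "y \<in> carrier loopQ" for y
  proof -
    obtain u a where x: "x = (u, a)" and [simp]: "u \<in> carrier grpB" "a \<in> carrier grpN"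
      using assms by (auto simp: carrier_loopQ)
    obtain v b where y: "y = (v, b)" and [simp]: "v \<in> carrier grpB" "b \<in> carrier grpN"
      using y_in by (auto simp: carrier_loopQ)
    have "quot_d (theta u v +\<^sub>N actN v a +\<^sub>N b) = (quot_d a \<otimes>\<^bsub>grpB\<^esub> quot_d b) \<otimes>\<^bsub>grpB\<^esub> theta_bar u v"
      "quot_d (theta v u +\<^sub>N actN u b +\<^sub>N a) = (quot_d a \<otimes>\<^bsub>grpB\<^esub> quot_d b) \<otimes>\<^bsub>grpB\<^esub> theta_bar v u"
      by (simp_all add: quot_d_add B.m_ac flip: theta_bar_def)
    moreover have "range z_pow #>\<^bsub>loopQ\<^esub> (x \<otimes>\<^bsub>loopQ\<^esub> y) = range z_pow #>\<^bsub>loopQ\<^esub> (y \<otimes>\<^bsub>loopQ\<^esub> x)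
        \<longleftrightarrow> quot_d (theta u v +\<^sub>N actN v a +\<^sub>N b) = quot_d (theta v u +\<^sub>N actN u b +\<^sub>N a)"
      using assms y_in
      by (simp add: QZ.rcos_eq_iff rcos_centre_eq_iff Q.m_closed) (simp add: x y mult_loopQ B.m_comm)
    ultimately show ?thesis
      by (simp add: x y B.Units_eq B.Units_l_cancel)
  qed
  have "(\<forall>v\<in>carrier grpB. theta_bar u v = theta_bar v u) \<longleftrightarrow> u = \<one>\<^bsub>grpB\<^esub>"
    if "u \<in> carrier grpB" for u
  proof -
    have "\<forall>u\<in>carrier grpB. (\<forall>v\<in>carrier grpB. theta_bar u v = theta_bar v u) \<longleftrightarrow> u = \<one>\<^bsub>grpB\<^esub>"
      unfolding Ball_grpB by (intro conjI; simp add: theta_bar_eq one_grpB)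
    then show ?thesis
      using that by blast
  qed
  moreover have "fst ` carrier loopQ = carrier grpB"
    using N.one_closed by (simp add: carrier_loopQ fst_image_times) blast
  then have "(\<forall>y\<in>carrier loopQ. P (fst y)) \<longleftrightarrow> (\<forall>v\<in>carrier grpB. P v)" for P
    by (metis (no_types, lifting) image_iff)
  ultimately show ?thesis
    using assms
    by (simp add: QZ.rcos_in_centre_Mod_iff rcos_centre_assoc comm) (auto simp: carrier_loopQ)
qed

lemma centre_Mod_centre:
  "centre (loopQ Mod range z_pow) = (\<lambda>x. range z_pow #>\<^bsub>loopQ\<^esub> x) ` kerN"
proof -
  have "centre (loopQ Mod range z_pow) \<subseteq> (\<lambda>x. range z_pow #>\<^bsub>loopQ\<^esub> x) ` carrier loopQ"
    by (auto simp: centre_def nucleus_def carrier_FactGroup)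
  moreover have "kerN \<subseteq> carrier loopQ"
    by (auto simp: carrier_loopQ)
  ultimately show ?thesis
    using centre_Mod_centre_iff by blast
qed

lemma upper_central_2: "upper_central loopQ 2 = kerN"
proof -
  have "upper_central loopQ 2 =
      {x \<in> carrier loopQ. range z_pow #>\<^bsub>loopQ\<^esub> x \<in> centre (loopQ Mod range z_pow)}"
    using Q.upper_central_1 by (simp add: numeral_2_eq_2 centre_loopQ del: upper_central.simps(1))
  then show ?thesis
    using centre_Mod_centre_iff QN.K_sub by blast
qed

lemma rcos_kerN_comm_assoc:
  assumes "x \<in> carrier loopQ" "y \<in> carrier loopQ"
  shows "kerN #>\<^bsub>loopQ\<^esub> (x \<otimes>\<^bsub>loopQ\<^esub> y) = kerN #>\<^bsub>loopQ\<^esub> (y \<otimes>\<^bsub>loopQ\<^esub> x)"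
    and "z \<in> carrier loopQ \<Longrightarrow> kerN #>\<^bsub>loopQ\<^esub> (x \<otimes>\<^bsub>loopQ\<^esub> (y \<otimes>\<^bsub>loopQ\<^esub> z)) = kerN #>\<^bsub>loopQ\<^esub> ((x \<otimes>\<^bsub>loopQ\<^esub> y) \<otimes>\<^bsub>loopQ\<^esub> z)"
  using assms by (simp_all add: rcos_kerN Q.m_closed fst_mult B.m_ac)

lemma upper_central_3: "upper_central loopQ 3 = carrier loopQ"
proof -
  have "upper_central loopQ (Suc 2) = {x \<in> carrier loopQ. kerN #>\<^bsub>loopQ\<^esub> x \<in> centre (loopQ Mod kerN)}"
    by (simp only: upper_central.simps upper_central_2)
  also have "\<dots> = carrier loopQ"
    using QN.rcos_in_centre_Mod_iff rcos_kerN_comm_assoc by blast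
  finally show ?thesis
    by (simp add: eval_nat_numeral)
qed

lemma nilpotency_class_loopQ: "has_nilpotency_class loopQ 3"
proof -
  define x where "x = (genB 1, \<one>\<^bsub>grpN\<^esub>)"
  have x: "x \<in> carrier loopQ" "fst x \<noteq> \<one>\<^bsub>grpB\<^esub>"
    by (simp_all add: x_def genB_def carrier_loopQ carrier_grpB one_grpB)
  have "x \<notin> upper_central loopQ m" if "m < 3" for m
  proof -
    consider "m = 0" | "m = 1" | "m = 2"
      using \<open>m < 3\<close> by linarith
    then show ?thesis
    proof cases
      case 1
      then show ?thesis using x by (auto simp: one_loopQ)
    next
      case 2
      then have "upper_central loopQ m = range z_pow"
        by (simp only: Q.upper_central_1 centre_loopQ)
      then show ?thesis
        using x by auto
    next
      case 3
      then show ?thesis using x by (auto simp: upper_central_2 simp del: upper_central.simps)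
    qed
  qed
  then show ?thesis
    using x upper_central_3 unfolding has_nilpotency_class_def by blast
qed

text \<open>
  Minimality: \<open>f(e\<^sub>1,e\<^sub>2,e\<^sub>3) = 1\<close>, so that \<open>(1,d)\<close> is itself an associator.
\<close>

lemma associator_subloop_loopQ: "associator_subloop loopQ = range z_pow"
  unfolding associator_subloop_def
proof (rule Least_equality)
  have "group (loopQ Mod range z_pow)"
    by (simp add: QZ.group_Mod_iff rcos_centre_assoc)
  then show "normal_subloop (range z_pow) loopQ \<and> group (loopQ Mod range z_pow)"
    using normal_centre by blast
  fix K assume K: "normal_subloop K loopQ \<and> group (loopQ Mod K)"
  then interpret K: normal_subloop_of loopQ K
    by unfold_locales blast
  define x y z where "x = (genB 1, \<one>\<^bsub>grpN\<^esub>)" and "y = (genB 2, \<one>\<^bsub>grpN\<^esub>)" and "z = (genB 3, \<one>\<^bsub>grpN\<^esub>)"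
  have [simp]: "x \<in> carrier loopQ" "y \<in> carrier loopQ" "z \<in> carrier loopQ"
    by (simp_all add: x_def y_def z_def genB_def carrier_loopQ carrier_grpB)
  have "assoc_form (fst x) (fst y) (fst z) = 1"
    by (simp add: x_def y_def z_def genB_def assoc_form_def)
  moreover have "K #>\<^bsub>loopQ\<^esub> ((x \<otimes>\<^bsub>loopQ\<^esub> y) \<otimes>\<^bsub>loopQ\<^esub> z) = K #>\<^bsub>loopQ\<^esub> (x \<otimes>\<^bsub>loopQ\<^esub> (y \<otimes>\<^bsub>loopQ\<^esub> z))"
    using K by (simp add: K.group_Mod_iff)
  ultimately have "K #>\<^bsub>loopQ\<^esub> (x \<otimes>\<^bsub>loopQ\<^esub> (y \<otimes>\<^bsub>loopQ\<^esub> z) \<otimes>\<^bsub>loopQ\<^esub> z_pow 1) = K #>\<^bsub>loopQ\<^esub> (x \<otimes>\<^bsub>loopQ\<^esub> (y \<otimes>\<^bsub>loopQ\<^esub> z))"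
    by (simp add: associator[of x y z])
  then have "z_pow 1 \<in> K"
    by (simp add: K.rcos_mult_right_iff Q.m_closed)
  moreover have "z_pow 0 \<in> K"
    using K.K_one by (simp add: z_pow_0)
  ultimately show "range z_pow \<le> K"
    unfolding range_z_pow by (simp add: z_pow_def d_pow_1)
qed

text \<open>
  Minimality: the commutators of the generators \<open>e\<^sub>1,e\<^sub>3\<close>, of \<open>e\<^sub>2,e\<^sub>1\<close> and of \<open>e\<^sub>3,e\<^sub>2\<close> have
  \<open>N\<close>-components \<open>h + c\<^sub>2\<close>, \<open>h + c\<^sub>3\<close> and \<open>h + c\<^sub>1\<close>.  Their sum is \<open>3h\<close>, which generates the
  subgroup of \<open>h\<close>, and adding it to each of the three elements gives the \<open>c\<^sub>i\<close>.
\<close>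

lemma derived_subloop_loopQ: "derived_subloop loopQ = kerN"
  unfolding derived_subloop_def
proof (rule Least_equality)
  have "comm_group (loopQ Mod kerN)"
    by (simp add: QN.comm_group_Mod_iff QN.group_Mod_iff rcos_kerN_comm_assoc)
  then show "normal_subloop kerN loopQ \<and> comm_group (loopQ Mod kerN)"
    using normal_kerN by blast
  fix K assume K: "normal_subloop K loopQ \<and> comm_group (loopQ Mod K)"
  then interpret K: normal_subloop_of loopQ K
    by unfold_locales blast
  have commutator: "c \<in> K"
    if "x \<in> carrier loopQ" "y \<in> carrier loopQ" "c \<in> carrier loopQ" "x \<otimes>\<^bsub>loopQ\<^esub> y = (y \<otimes>\<^bsub>loopQ\<^esub> x) \<otimes>\<^bsub>loopQ\<^esub> c" for x y c
    using that K K.rcos_mult_right_iff[of "y \<otimes>\<^bsub>loopQ\<^esub> x" c] by (simp add: K.comm_group_Mod_iff Q.m_closed)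
  have gen: "(genB i, \<one>\<^bsub>grpN\<^esub>) \<in> carrier loopQ" for i
    by (simp add: genB_def carrier_loopQ carrier_grpB)
  define M where "M = {n \<in> carrier grpN. (\<one>\<^bsub>grpB\<^esub>, n) \<in> K}"
  have M: "n \<in> M" if "n \<in> carrier grpN"
    "(genB i, \<one>\<^bsub>grpN\<^esub>) \<otimes>\<^bsub>loopQ\<^esub> (genB j, \<one>\<^bsub>grpN\<^esub>) = ((genB j, \<one>\<^bsub>grpN\<^esub>) \<otimes>\<^bsub>loopQ\<^esub> (genB i, \<one>\<^bsub>grpN\<^esub>)) \<otimes>\<^bsub>loopQ\<^esub> (\<one>\<^bsub>grpB\<^esub>, n)"
    for i j n
    using that commutator[OF gen gen _ that(2)] by (simp add: M_def carrier_loopQ)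
  have M': "n \<in> M" if "n \<in> carrier grpN" "i \<in> {1, 2, 3}" "j \<in> {1, 2, 3}"
      "theta (genB i) (genB j) = theta (genB j) (genB i) +\<^sub>N n" for i j n
  proof (rule M)
    have B: "genB i \<in> carrier grpB" for i
      by (simp add: genB_def carrier_grpB)
    show "(genB i, \<one>\<^bsub>grpN\<^esub>) \<otimes>\<^bsub>loopQ\<^esub> (genB j, \<one>\<^bsub>grpN\<^esub>) = ((genB j, \<one>\<^bsub>grpN\<^esub>) \<otimes>\<^bsub>loopQ\<^esub> (genB i, \<one>\<^bsub>grpN\<^esub>)) \<otimes>\<^bsub>loopQ\<^esub> (\<one>\<^bsub>grpB\<^esub>, n)"
      using that(1,4) B by (simp add: mult_loopQ actN_one B.m_comm)
  qed fact
  have add: "a +\<^sub>N b \<in> M" if "a \<in> M" "b \<in> M" for a b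
    using that K.K_mult[of "(\<one>\<^bsub>grpB\<^esub>, a)" "(\<one>\<^bsub>grpB\<^esub>, b)"] by (simp add: M_def mult_loopQ actN_one)
  have zero: "(0, 0, 0) \<in> M"
    using K.K_one by (simp add: M_def one_loopQ flip: one_grpN)
  have m1: "(1, 0, 1) \<in> M" and m2: "(1, 1, 1) \<in> M" and m3: "(1, 1, 0) \<in> M"
    using M'[of "(1, 0, 1)" 1 3] M'[of "(1, 1, 1)" 2 1] M'[of "(1, 1, 0)" 3 2]
    by (simp_all add: carrier_grpN genB_def theta_eq add_grpN)
  have h3: "(3, 0, 0) \<in> M"
    using add[OF add[OF m1 m2] m3] by (simp add: add_grpN)
  then have h2: "(2, 0, 0) \<in> M"
    using add[OF h3 h3] by (simp add: add_grpN)
  then have h1: "(1, 0, 0) \<in> M"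
    using add[OF h2 h3] by (simp add: add_grpN)
  have c: "(0, 0, 1) \<in> M" "(0, 1, 1) \<in> M" "(0, 1, 0) \<in> M"
    using add[OF m1 h3] add[OF m2 h3] add[OF m3 h3] by (simp_all add: add_grpN)
  have "\<forall>a\<in>carrier grpN. a \<in> M"
  proof
    fix a assume a: "a \<in> carrier grpN"
    obtain i j k where ijk: "a = (i, j, k)"
      by (cases a)
    have "(i, 0, 0) \<in> M" "(0, j, k) \<in> M"
      using a zero h1 h2 h3 c by (auto simp: ijk carrier_grpN)
    then have "(i, 0, 0) +\<^sub>N (0, j, k) \<in> M"
      by (rule add)
    then show "a \<in> M"
      using a by (auto simp: ijk add_grpN carrier_grpN_iff)
  qed
  then show "kerN \<le> K"
    by (auto simp: M_def)
qed

section \<open>The multiplication group\<close>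

definition affine_map ::
  "int \<times> int \<times> int \<Rightarrow> int \<times> int \<times> int \<Rightarrow> (int \<times> int \<times> int \<Rightarrow> int \<times> int \<times> int)
    \<Rightarrow> (int \<times> int \<times> int) \<times> (int \<times> int \<times> int) \<Rightarrow> (int \<times> int \<times> int) \<times> (int \<times> int \<times> int)" where
  "affine_map w v G = (\<lambda>x\<in>carrier loopQ. (fst x \<otimes>\<^bsub>grpB\<^esub> w, actN v (snd x) +\<^sub>N G (fst x)))"

text \<open>
  The affine maps whose translation part is, modulo \<open>d\<close>, tied to the linear data \<open>w\<close>, \<open>v\<close> up to
  a constant.  The condition on \<open>G\<close> is what is preserved by composition and satisfied by both
  kinds of translations; without it the stabilizer of the unit element would not be abelian.
\<close>

definition mlt_maps ::
  "((int \<times> int \<times> int) \<times> (int \<times> int \<times> int) \<Rightarrow> (int \<times> int \<times> int) \<times> (int \<times> int \<times> int)) set" where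
  "mlt_maps = {affine_map w v G | w v G. w \<in> carrier grpB \<and> v \<in> carrier grpB \<and>
     G \<in> carrier grpB \<rightarrow> carrier grpN \<and>
     (\<exists>b\<in>carrier grpB. \<forall>u\<in>carrier grpB.
        quot_d (G u) = theta_bar (w \<otimes>\<^bsub>grpB\<^esub> v) u \<otimes>\<^bsub>grpB\<^esub> theta_bar u v \<otimes>\<^bsub>grpB\<^esub> b)}"

lemma mlt_mapsI:
  assumes "w \<in> carrier grpB" "v \<in> carrier grpB" "b \<in> carrier grpB"
    and "\<And>u. u \<in> carrier grpB \<Longrightarrow> G u \<in> carrier grpN"
    and "\<And>u. u \<in> carrier grpB \<Longrightarrow>
      quot_d (G u) = theta_bar (w \<otimes>\<^bsub>grpB\<^esub> v) u \<otimes>\<^bsub>grpB\<^esub> theta_bar u v \<otimes>\<^bsub>grpB\<^esub> b"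
  shows "affine_map w v G \<in> mlt_maps"
  unfolding mlt_maps_def using assms by blast

lemma mlt_mapsE:
  assumes "f \<in> mlt_maps"
  obtains w v G b where "f = affine_map w v G"
    and "w \<in> carrier grpB" "v \<in> carrier grpB" "b \<in> carrier grpB"
    and "\<And>u. u \<in> carrier grpB \<Longrightarrow> G u \<in> carrier grpN"
    and "\<And>u. u \<in> carrier grpB \<Longrightarrow>
      quot_d (G u) = theta_bar (w \<otimes>\<^bsub>grpB\<^esub> v) u \<otimes>\<^bsub>grpB\<^esub> theta_bar u v \<otimes>\<^bsub>grpB\<^esub> b"
  using assms unfolding mlt_maps_def by blast

lemma affine_map_cong:
  assumes "w = w'" "v = v'" "\<And>u a. \<lbrakk>u \<in> carrier grpB; a \<in> carrier grpN\<rbrakk> \<Longrightarrow> G u = G' u"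
  shows "affine_map w v G = affine_map w' v' G'"
  unfolding affine_map_def using assms by (auto simp: carrier_loopQ intro!: restrict_ext)

lemma affine_map_apply:
  "\<lbrakk>u \<in> carrier grpB; a \<in> carrier grpN\<rbrakk> \<Longrightarrow> affine_map w v G (u, a) = (u \<otimes>\<^bsub>grpB\<^esub> w, actN v a +\<^sub>N G u)"
  by (simp add: affine_map_def carrier_loopQ)

lemma affine_map_compose:
  assumes "w \<in> carrier grpB" "v \<in> carrier grpB" "w' \<in> carrier grpB" "v' \<in> carrier grpB"
    and "\<And>u. u \<in> carrier grpB \<Longrightarrow> G u \<in> carrier grpN" "\<And>u. u \<in> carrier grpB \<Longrightarrow> G' u \<in> carrier grpN"
  shows "compose (carrier loopQ) (affine_map w v G) (affine_map w' v' G')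
    = affine_map (w' \<otimes>\<^bsub>grpB\<^esub> w) (v \<otimes>\<^bsub>grpB\<^esub> v') (\<lambda>u. actN v (G' u) +\<^sub>N G (u \<otimes>\<^bsub>grpB\<^esub> w'))"
proof (rule extensionalityI[of _ "carrier loopQ"])
  fix x assume "x \<in> carrier loopQ"
  then obtain u a where x: "x = (u, a)" "u \<in> carrier grpB" "a \<in> carrier grpN"
    by (auto simp: carrier_loopQ)
  then show "compose (carrier loopQ) (affine_map w v G) (affine_map w' v' G') x
    = affine_map (w' \<otimes>\<^bsub>grpB\<^esub> w) (v \<otimes>\<^bsub>grpB\<^esub> v') (\<lambda>u. actN v (G' u) +\<^sub>N G (u \<otimes>\<^bsub>grpB\<^esub> w')) x"
    using assms
    by (simp add: compose_eq carrier_loopQ affine_map_apply actN_add actN_mult actN_closed B.m_assoc N.m_assoc)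
qed (simp_all add: affine_map_def)

lemma affine_map_id: "affine_map \<one>\<^bsub>grpB\<^esub> \<one>\<^bsub>grpB\<^esub> (\<lambda>u. \<one>\<^bsub>grpN\<^esub>) = (\<lambda>x\<in>carrier loopQ. x)"
  unfolding affine_map_def by (rule restrict_ext) (auto simp: carrier_loopQ actN_one)

lemma affine_map_inverse:
  assumes "w \<in> carrier grpB" "v \<in> carrier grpB"
    and "\<And>u. u \<in> carrier grpB \<Longrightarrow> G u \<in> carrier grpN"
  defines "G' \<equiv> \<lambda>u. actN v (inv\<^bsub>grpN\<^esub> (G (u \<otimes>\<^bsub>grpB\<^esub> w)))"
  shows "compose (carrier loopQ) (affine_map w v G') (affine_map w v G) = (\<lambda>x\<in>carrier loopQ. x)"
    and "compose (carrier loopQ) (affine_map w v G) (affine_map w v G') = (\<lambda>x\<in>carrier loopQ. x)"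
proof -
  have ww: "u \<otimes>\<^bsub>grpB\<^esub> w \<otimes>\<^bsub>grpB\<^esub> w = u" if "u \<in> carrier grpB" for u
    using that assms by (simp add: B.m_assoc grpB_square)
  have act0: "actN v a +\<^sub>N actN v (inv\<^bsub>grpN\<^esub> a) = \<one>\<^bsub>grpN\<^esub>" if "a \<in> carrier grpN" for a
    using that assms by (simp flip: actN_add)
  have G': "G' u \<in> carrier grpN" if "u \<in> carrier grpB" for u
    using that assms by (simp add: actN_closed)
  show "compose (carrier loopQ) (affine_map w v G') (affine_map w v G) = (\<lambda>x\<in>carrier loopQ. x)"
    unfolding affine_map_id[symmetric] using assms G'
    by (simp add: affine_map_compose grpB_square)
      (intro affine_map_cong; simp add: ww act0)
  show "compose (carrier loopQ) (affine_map w v G) (affine_map w v G') = (\<lambda>x\<in>carrier loopQ. x)"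
    unfolding affine_map_id[symmetric] using assms G'
    by (simp add: affine_map_compose grpB_square)
      (intro affine_map_cong; simp add: ww)
qed

lemma affine_map_Bij:
  assumes "w \<in> carrier grpB" "v \<in> carrier grpB"
    and "\<And>u. u \<in> carrier grpB \<Longrightarrow> G u \<in> carrier grpN"
  shows "affine_map w v G \<in> Bij (carrier loopQ)"
proof -
  define G' where "G' = (\<lambda>u. actN v (inv\<^bsub>grpN\<^esub> (G (u \<otimes>\<^bsub>grpB\<^esub> w))))"
  have closed: "affine_map w v H \<in> carrier loopQ \<rightarrow> carrier loopQ"
    if "\<And>u. u \<in> carrier grpB \<Longrightarrow> H u \<in> carrier grpN" for H
    using that assms by (auto simp: carrier_loopQ affine_map_apply actN_closed)
  have inverse: "f (g x) = x"
    if "compose (carrier loopQ) f g = (\<lambda>x\<in>carrier loopQ. x)" "x \<in> carrier loopQ" for f g x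
    using fun_cong[OF that(1), of x] that(2) by (simp add: compose_eq)
  have "bij_betw (affine_map w v G) (carrier loopQ) (carrier loopQ)"
  proof (rule bij_betw_byWitness[where f' = "affine_map w v G'"])
    show "\<forall>x\<in>carrier loopQ. affine_map w v G' (affine_map w v G x) = x"
      using inverse[OF affine_map_inverse(1)] assms by (simp add: G'_def)
    show "\<forall>x\<in>carrier loopQ. affine_map w v G (affine_map w v G' x) = x"
      using inverse[OF affine_map_inverse(2)] assms by (simp add: G'_def)
    show "affine_map w v G ` carrier loopQ \<subseteq> carrier loopQ"
      using closed[of G] assms by blast
    have "G' u \<in> carrier grpN" if "u \<in> carrier grpB" for u
      using that assms by (simp add: G'_def actN_closed)
    then show "affine_map w v G' ` carrier loopQ \<subseteq> carrier loopQ"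
      using closed[of G'] by blast
  qed
  then show ?thesis
    by (simp add: Bij_def affine_map_def)
qed

lemma quot_d_inv: "a \<in> carrier grpN \<Longrightarrow> quot_d (inv\<^bsub>grpN\<^esub> a) = quot_d a"
  using quot_d_add[of "inv\<^bsub>grpN\<^esub> a" a] B.inv_equality[of "quot_d (inv\<^bsub>grpN\<^esub> a)" "quot_d a"]
  by (simp add: grpB_inv)

text \<open>
  Composition adds the bilinear expressions in \<open>u\<close>; shifting \<open>u\<close> to \<open>uw'\<close> changes them only by
  terms independent of \<open>u\<close>, which go into the constant.
\<close>

lemma subgroup_mlt_maps: "subgroup mlt_maps (BijGroup (carrier loopQ))"
proof -
  let ?S = "BijGroup (carrier loopQ)"
  interpret S: group ?S
    by (rule group_BijGroup)
  have Bij: "f \<in> Bij (carrier loopQ)" if "f \<in> mlt_maps" for f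
    using that by (elim mlt_mapsE) (simp add: affine_map_Bij)
  have theta_bar_one: "theta_bar u \<one>\<^bsub>grpB\<^esub> = \<one>\<^bsub>grpB\<^esub>" "theta_bar \<one>\<^bsub>grpB\<^esub> u = \<one>\<^bsub>grpB\<^esub>" for u
    by (simp_all add: theta_bar_def)
  show ?thesis
  proof (rule S.subgroupI)
    show "mlt_maps \<subseteq> carrier ?S"
      using Bij by (auto simp: BijGroup_def)
    have "affine_map \<one>\<^bsub>grpB\<^esub> \<one>\<^bsub>grpB\<^esub> (\<lambda>u. \<one>\<^bsub>grpN\<^esub>) \<in> mlt_maps"
      by (rule mlt_mapsI[of _ _ "\<one>\<^bsub>grpB\<^esub>"]) (simp_all add: theta_bar_one)
    then show "mlt_maps \<noteq> {}"
      by blast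
  next
    fix f assume f: "f \<in> mlt_maps"
    obtain w v G b where f_eq: "f = affine_map w v G"
      and [simp]: "w \<in> carrier grpB" "v \<in> carrier grpB" "b \<in> carrier grpB"
      and [simp]: "\<And>u. u \<in> carrier grpB \<Longrightarrow> G u \<in> carrier grpN"
      and G: "\<And>u. u \<in> carrier grpB \<Longrightarrow>
        quot_d (G u) = theta_bar (w \<otimes>\<^bsub>grpB\<^esub> v) u \<otimes>\<^bsub>grpB\<^esub> theta_bar u v \<otimes>\<^bsub>grpB\<^esub> b"
      by (rule mlt_mapsE[OF f]) (rule that; blast)
    define g where "g = affine_map w v (\<lambda>u. actN v (inv\<^bsub>grpN\<^esub> (G (u \<otimes>\<^bsub>grpB\<^esub> w))))"
    have g: "g \<in> mlt_maps"
      unfolding g_def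
      by (rule mlt_mapsI[of _ _ "theta_bar (w \<otimes>\<^bsub>grpB\<^esub> v) w \<otimes>\<^bsub>grpB\<^esub> theta_bar w v \<otimes>\<^bsub>grpB\<^esub> b"])
        (simp_all add: actN_closed quot_d_inv G theta_bar_mult_left theta_bar_mult_right B.m_ac)
    have "compose (carrier loopQ) g f = (\<lambda>x\<in>carrier loopQ. x)"
      unfolding f_eq g_def by (rule affine_map_inverse) simp_all
    then have "g \<otimes>\<^bsub>?S\<^esub> f = \<one>\<^bsub>?S\<^esub>"
      using f g Bij by (simp add: BijGroup_def)
    then have "inv\<^bsub>?S\<^esub> f = g"
      using f g Bij by (intro S.inv_equality) (simp_all add: BijGroup_def)
    then show "inv\<^bsub>?S\<^esub> f \<in> mlt_maps"
      using g by simp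
  next
    fix f f' assume f: "f \<in> mlt_maps" and f': "f' \<in> mlt_maps"
    obtain w v G b where f_eq: "f = affine_map w v G"
      and [simp]: "w \<in> carrier grpB" "v \<in> carrier grpB" "b \<in> carrier grpB"
      and [simp]: "\<And>u. u \<in> carrier grpB \<Longrightarrow> G u \<in> carrier grpN"
      and G: "\<And>u. u \<in> carrier grpB \<Longrightarrow>
        quot_d (G u) = theta_bar (w \<otimes>\<^bsub>grpB\<^esub> v) u \<otimes>\<^bsub>grpB\<^esub> theta_bar u v \<otimes>\<^bsub>grpB\<^esub> b"
      by (rule mlt_mapsE[OF f]) (rule that; blast)
    obtain w' v' G' b' where f'_eq: "f' = affine_map w' v' G'"
      and [simp]: "w' \<in> carrier grpB" "v' \<in> carrier grpB" "b' \<in> carrier grpB"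
      and [simp]: "\<And>u. u \<in> carrier grpB \<Longrightarrow> G' u \<in> carrier grpN"
      and G': "\<And>u. u \<in> carrier grpB \<Longrightarrow>
        quot_d (G' u) = theta_bar (w' \<otimes>\<^bsub>grpB\<^esub> v') u \<otimes>\<^bsub>grpB\<^esub> theta_bar u v' \<otimes>\<^bsub>grpB\<^esub> b'"
      by (rule mlt_mapsE[OF f']) (rule that; blast)
    let ?b = "b' \<otimes>\<^bsub>grpB\<^esub> (theta_bar (w \<otimes>\<^bsub>grpB\<^esub> v) w' \<otimes>\<^bsub>grpB\<^esub> theta_bar w' v \<otimes>\<^bsub>grpB\<^esub> b)"
    have "affine_map (w' \<otimes>\<^bsub>grpB\<^esub> w) (v \<otimes>\<^bsub>grpB\<^esub> v') (\<lambda>u. actN v (G' u) +\<^sub>N G (u \<otimes>\<^bsub>grpB\<^esub> w')) \<in> mlt_maps"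
      by (rule mlt_mapsI[of _ _ ?b])
        (simp_all add: actN_closed quot_d_add G G' theta_bar_mult_left theta_bar_mult_right B.m_ac)
    then have "compose (carrier loopQ) f f' \<in> mlt_maps"
      unfolding f_eq f'_eq by (simp add: affine_map_compose)
    then show "f \<otimes>\<^bsub>?S\<^esub> f' \<in> mlt_maps"
      using f f' Bij by (simp add: BijGroup_def)
  qed
qed

text \<open>
  For \<open>x = (v,b)\<close>, left translation is affine with data \<open>(v,1)\<close> and right translation with data
  \<open>(v,v)\<close>; in the latter case \<open>wv = v\<^sup>2 = 1\<close> removes the term \<open>\<theta>'(wv,u)\<close>.
\<close>

lemma translations_in_mlt_maps:
  assumes "x \<in> carrier loopQ"
  shows "left_translation loopQ x \<in> mlt_maps" "right_translation loopQ x \<in> mlt_maps"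
proof -
  obtain v b where x: "x = (v, b)" and [simp]: "v \<in> carrier grpB" "b \<in> carrier grpN"
    using assms by (auto simp: carrier_loopQ)
  have "left_translation loopQ x = affine_map v \<one>\<^bsub>grpB\<^esub> (\<lambda>u. theta v u +\<^sub>N actN u b)"
    unfolding left_translation_def affine_map_def
    by (rule restrict_ext) (auto simp: x carrier_loopQ mult_loopQ actN_one actN_closed B.m_comm N.m_ac)
  moreover have "affine_map v \<one>\<^bsub>grpB\<^esub> (\<lambda>u. theta v u +\<^sub>N actN u b) \<in> mlt_maps"
    by (rule mlt_mapsI[of _ _ "quot_d b"])
      (simp_all add: actN_closed quot_d_add theta_bar_def)
  ultimately show "left_translation loopQ x \<in> mlt_maps"
    by simp
  have "right_translation loopQ x = affine_map v v (\<lambda>u. theta u v +\<^sub>N b)"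
    unfolding right_translation_def affine_map_def
    by (rule restrict_ext) (auto simp: x carrier_loopQ mult_loopQ actN_closed N.m_ac)
  moreover have "affine_map v v (\<lambda>u. theta u v +\<^sub>N b) \<in> mlt_maps"
    by (rule mlt_mapsI[of _ _ "quot_d b"])
      (simp_all add: quot_d_add theta_bar_def grpB_square)
  ultimately show "right_translation loopQ x \<in> mlt_maps"
    by simp
qed

lemma inner_mlt_mapsE:
  assumes "f \<in> mlt_maps" "f \<one>\<^bsub>loopQ\<^esub> = \<one>\<^bsub>loopQ\<^esub>"
  obtains v G where "f = affine_map \<one>\<^bsub>grpB\<^esub> v G" "v \<in> carrier grpB"
    and "\<And>u. u \<in> carrier grpB \<Longrightarrow> G u \<in> carrier grpN"
    and "\<And>u. u \<in> carrier grpB \<Longrightarrow> quot_d (G u) = theta_bar v u \<otimes>\<^bsub>grpB\<^esub> theta_bar u v"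
proof -
  obtain w v G b where f: "f = affine_map w v G"
    and [simp]: "w \<in> carrier grpB" "v \<in> carrier grpB" "b \<in> carrier grpB"
    and GN [simp]: "\<And>u. u \<in> carrier grpB \<Longrightarrow> G u \<in> carrier grpN"
    and G: "\<And>u. u \<in> carrier grpB \<Longrightarrow>
      quot_d (G u) = theta_bar (w \<otimes>\<^bsub>grpB\<^esub> v) u \<otimes>\<^bsub>grpB\<^esub> theta_bar u v \<otimes>\<^bsub>grpB\<^esub> b"
    by (rule mlt_mapsE[OF assms(1)]) (rule that; blast)
  have w: "w = \<one>\<^bsub>grpB\<^esub>" and G1: "G \<one>\<^bsub>grpB\<^esub> = \<one>\<^bsub>grpN\<^esub>"
    using assms(2) by (simp_all add: f one_loopQ affine_map_apply)
  have b: "b = \<one>\<^bsub>grpB\<^esub>"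
    using G[OF B.one_closed] by (simp add: G1 theta_bar_def)
  show thesis
    by (rule that[of v G]) (use f G in \<open>simp_all add: w b\<close>)
qed

text \<open>
  The two composites differ in their translation parts by
  \<open>(\<lambda>(v,[v',u]) - \<lambda>(v',[v,u])) d\<close>, which is 0 by the symmetry of the permanent.
\<close>

lemma inner_mlt_maps_commute:
  assumes "f \<in> mlt_maps" "f \<one>\<^bsub>loopQ\<^esub> = \<one>\<^bsub>loopQ\<^esub>" "g \<in> mlt_maps" "g \<one>\<^bsub>loopQ\<^esub> = \<one>\<^bsub>loopQ\<^esub>"
  shows "compose (carrier loopQ) f g = compose (carrier loopQ) g f"
proof -
  obtain v G where f: "f = affine_map \<one>\<^bsub>grpB\<^esub> v G" and [simp]: "v \<in> carrier grpB"
    and [simp]: "\<And>u. u \<in> carrier grpB \<Longrightarrow> G u \<in> carrier grpN"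
    and G: "\<And>u. u \<in> carrier grpB \<Longrightarrow> quot_d (G u) = theta_bar v u \<otimes>\<^bsub>grpB\<^esub> theta_bar u v"
    using inner_mlt_mapsE[OF assms(1,2)] by blast
  obtain v' G' where g: "g = affine_map \<one>\<^bsub>grpB\<^esub> v' G'" and [simp]: "v' \<in> carrier grpB"
    and [simp]: "\<And>u. u \<in> carrier grpB \<Longrightarrow> G' u \<in> carrier grpN"
    and G': "\<And>u. u \<in> carrier grpB \<Longrightarrow> quot_d (G' u) = theta_bar v' u \<otimes>\<^bsub>grpB\<^esub> theta_bar u v'"
    using inner_mlt_mapsE[OF assms(3,4)] by blast
  have "actN v (G' u) +\<^sub>N G u = actN v' (G u) +\<^sub>N G' u" if [simp]: "u \<in> carrier grpB" for u
  proof -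
    have "d_pow (act_form v (quot_d (G' u))) = d_pow (act_form v' (quot_d (G u)))"
      by (simp add: d_pow_eq_iff G G' act_form_theta_bar)
    then show ?thesis
      by (simp add: act_eq N.m_ac)
  qed
  then show ?thesis
    unfolding f g
    by (simp add: affine_map_compose) (intro affine_map_cong; simp add: B.m_comm)
qed

lemma comm_group_inner_mapping_group: "comm_group (inner_mapping_group loopQ)"
proof -
  let ?S = "BijGroup (carrier loopQ)"
  let ?T = "left_translation loopQ ` carrier loopQ \<union> right_translation loopQ ` carrier loopQ"
  let ?I = "{f \<in> generate ?S ?T. f \<one>\<^bsub>loopQ\<^esub> = \<one>\<^bsub>loopQ\<^esub>}"
  interpret S: group ?S
    by (rule group_BijGroup)
  have T: "?T \<subseteq> mlt_maps"
    using translations_in_mlt_maps by blast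
  have M: "mlt_maps \<subseteq> carrier ?S"
    by (rule subgroup.subset[OF subgroup_mlt_maps])
  have gen: "generate ?S ?T \<subseteq> mlt_maps"
    using S.generate_subgroup_incl[OF T subgroup_mlt_maps] .
  have "subgroup (generate ?S ?T) ?S"
    using T M by (intro S.generate_is_subgroup) blast
  then have "subgroup ?I ?S"
    by (rule subgroup_stabilizer) (rule Q.one_closed)
  then have "group (?S\<lparr>carrier := ?I\<rparr>)"
    by (rule S.subgroup_imp_group)
  moreover have "f \<otimes>\<^bsub>?S\<^esub> g = g \<otimes>\<^bsub>?S\<^esub> f" if "f \<in> ?I" "g \<in> ?I" for f g
  proof -
    have "f \<in> mlt_maps" "g \<in> mlt_maps"
      using that gen by blast+
    then show ?thesis
      using that M inner_mlt_maps_commute[of f g] by (auto simp: BijGroup_def)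
  qed
  ultimately have "comm_group (?S\<lparr>carrier := ?I\<rparr>)"
    by (intro group.group_comm_groupI) simp_all
  then show ?thesis
    by (simp add: inner_mapping_group_def)
qed

section \<open>Properties of the loop\<close>

theorem proposition8p6:
  shows "order loopQ = 128
    \<and> buchsteiner_loop loopQ
    \<and> \<not> conjugacy_closed_loop loopQ
    \<and> has_nilpotency_class loopQ 3
    \<and> comm_group (inner_mapping_group loopQ)
    \<and> nucleus loopQ = {\<one>\<^bsub>grpB\<^esub>} \<times> carrier grpN
    \<and> nucleus loopQ = derived_subloop loopQ
    \<and> centre loopQ = {(\<one>\<^bsub>grpB\<^esub>, \<one>\<^bsub>grpN\<^esub>), (\<one>\<^bsub>grpB\<^esub>, dN)}
    \<and> centre loopQ = associator_subloop loopQ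
    \<and> centre (loopQ Mod centre loopQ) =
        carrier (loopQ\<lparr>carrier := nucleus loopQ\<rparr> Mod centre loopQ)"
proof (intro conjI)
  show "order loopQ = 128"
    by (simp add: order_def carrier_loopQ carrier_grpB carrier_grpN card_cartesian_product)
  show "centre loopQ = {(\<one>\<^bsub>grpB\<^esub>, \<one>\<^bsub>grpN\<^esub>), (\<one>\<^bsub>grpB\<^esub>, dN)}"
    by (simp add: centre_loopQ range_z_pow)
  show "centre (loopQ Mod centre loopQ) = carrier (loopQ\<lparr>carrier := nucleus loopQ\<rparr> Mod centre loopQ)"
    by (simp add: centre_loopQ centre_Mod_centre nucleus_loopQ carrier_FactGroup r_coset_def)
qed (simp_all add: buchsteiner_loopQ not_conjugacy_closed_loopQ nilpotency_class_loopQ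
    comm_group_inner_mapping_group nucleus_loopQ derived_subloop_loopQ centre_loopQ
    associator_subloop_loopQ)

end
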